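(* Let $a>0$ be an integer and let $D$ be an undecorated chord diagram. Then $D$ has arc number $\ge a+2$ if and only if there exists a positive integer $t$ such that $D$ contains the star $S_{t,a}$ as a subdiagram (that is, some subdiagram of $D$ is equivalent to $S_{t,a}$).
   Context: An undecorated chord diagram $D=(C,H,X)$ consists of an oriented circle $C$, a set $H\subset C$ of half-crossings having finite, even cardinality, and a partition $X$ of $H$ into two-element sets, called (full) crossings. Two undecorated chord diagrams $D=(C,H,X)$ and $D'=(C',H',X')$ are equivalent if there is an orientation-preserving homeomorphism $\phi:C\to C'$ such that $\{\phi(x)\mid x\in X\}=X'$. A subdiagram of $D=(C,H,X)$ is an undecorated chord diagram $D'=(C,H',X')$ on the same oriented circle with $X'\subset X$ and $H'=\bigcup X'$. A regular point of $D$ is an element of $C\setminus H$. A regular arc is an open arc $r\subset C$ with $\partial r\subset C\setminus H$ (the complement of a single regular point counts as an open arc; the whole circle $C$ does not). A regular arc is properly embedded if it contains no full crossing, i.e. there is no $x\in X$ with $x\subset r$. An embedded partition of $D$ is a finite set of regular points, called cut points, such that every component of the complement in $C$ of this set is a properly embedded regular arc. The arc number of $D$ is the smallest number of arcs (equivalently, of cut points) in an embedded partition of $D$. For integers $a\ge 0$ and $t\ge 1$, the star $S_{t,a}$ is the undecorated chord diagram with $2+2(a+1)t$ half-crossings $h_0,h_1,\dots,h_{1+2(a+1)t}$, numbered in cyclic order along $C$ respecting the orientation, with subscripts taken modulo $2+2(a+1)t$, and with the $1+(a+1)t$ crossings $c_j=\{h_j,h_{j+2t-1}\}$, where $j$ ranges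 over all the integers in $[0,1+2(a+1)t]$ of one fixed parity. Up to equivalence, $S_{t,a}$ depends only on $t$ and $a$. *)

theory Defs
  imports "HOL-Analysis.Analysis"
begin

section \<open>Oriented circles\<close>

text \<open>
  An oriented circle is a topological space together with an orientation, and the latter is given
  by a homeomorphism \<open>positive_param\<close> from the unit circle of the complex plane (oriented
  counterclockwise). Only the orientation class of this homeomorphism matters: the definitions
  below do not change if it is composed with an orientation-preserving homeomorphism
  of the unit circle.
\<close>

record 'p ocircle =
  space_of :: "'p topology"
  positive_param :: "complex \<Rightarrow> 'p"

abbreviation points :: "'p ocircle \<Rightarrow> 'p set" where
  "points C \<equiv> topspace (space_of C)"

definition oriented_circle :: "'p ocircle \<Rightarrow> bool" where
  "oriented_circle C \<longleftrightarrow>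
     homeomorphic_map (top_of_set (sphere 0 1)) (space_of C) (positive_param C)"

definition standard_circle :: "complex ocircle" where
  "standard_circle = \<lparr>space_of = top_of_set (sphere 0 1), positive_param = (\<lambda>z. z)\<rparr>"

text \<open>A homeomorphism preserves the orientation iff, in the angular coordinates, it
  lifts to an increasing map of the real line.\<close>

definition orientation_preserving_homeo ::
    "'p ocircle \<Rightarrow> 'q ocircle \<Rightarrow> ('p \<Rightarrow> 'q) \<Rightarrow> bool" where
  "orientation_preserving_homeo C C' \<phi> \<longleftrightarrow>
     homeomorphic_map (space_of C) (space_of C') \<phi> \<and>
     (\<exists>g :: real \<Rightarrow> real. continuous_on UNIV g \<and> strict_mono g \<and>
        (\<forall>s. \<phi> (positive_param C (cis s)) = positive_param C' (cis (g s))))"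

text \<open>The case \<open>\<beta> = \<alpha> + 2 * pi\<close> gives the complement of a point;
  the whole circle is not an open arc.\<close>

definition open_arc :: "'p ocircle \<Rightarrow> 'p set \<Rightarrow> bool" where
  "open_arc C r \<longleftrightarrow>
     (\<exists>\<alpha> \<beta> :: real. \<alpha> < \<beta> \<and> \<beta> \<le> \<alpha> + 2 * pi \<and>
        r = (\<lambda>s. positive_param C (cis s)) ` {\<alpha><..<\<beta>})"


section \<open>Undecorated chord diagrams\<close>

record 'p diagram =
  circle :: "'p ocircle"
  half_crossings :: "'p set"
  crossings :: "'p set set"

definition chord_diagram :: "'p diagram \<Rightarrow> bool" where
  "chord_diagram D \<longleftrightarrow>
     oriented_circle (circle D) \<and>
     half_crossings D \<subseteq> points (circle D) \<and>
     finite (half_crossings D) \<and> even (card (half_crossings D)) \<and>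
     partition_on (half_crossings D) (crossings D) \<and>
     (\<forall>x\<in>crossings D. card x = 2)"

definition equivalent :: "'p diagram \<Rightarrow> 'q diagram \<Rightarrow> bool" where
  "equivalent D D' \<longleftrightarrow>
     (\<exists>\<phi>. orientation_preserving_homeo (circle D) (circle D') \<phi> \<and>
          {\<phi> ` x | x. x \<in> crossings D} = crossings D')"

definition subdiagram :: "'p diagram \<Rightarrow> 'p diagram \<Rightarrow> bool" where
  "subdiagram D' D \<longleftrightarrow>
     chord_diagram D' \<and> circle D' = circle D \<and>
     crossings D' \<subseteq> crossings D \<and> half_crossings D' = \<Union> (crossings D')"

definition contains :: "'p diagram \<Rightarrow> 'q diagram \<Rightarrow> bool" where
  "contains D S \<longleftrightarrow> (\<exists>D'. subdiagram D' D \<and> equivalent D' S)"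


section \<open>Arc number\<close>

definition regular_points :: "'p diagram \<Rightarrow> 'p set" where
  "regular_points D = points (circle D) - half_crossings D"

definition regular_arc :: "'p diagram \<Rightarrow> 'p set \<Rightarrow> bool" where
  "regular_arc D r \<longleftrightarrow>
     open_arc (circle D) r \<and> space_of (circle D) frontier_of r \<subseteq> regular_points D"

definition properly_embedded :: "'p diagram \<Rightarrow> 'p set \<Rightarrow> bool" where
  "properly_embedded D r \<longleftrightarrow> regular_arc D r \<and> \<not> (\<exists>x\<in>crossings D. x \<subseteq> r)"

text \<open>The empty set of cut points is excluded here, because the whole circle is not an arc.\<close>

definition embedded_partition :: "'p diagram \<Rightarrow> 'p set \<Rightarrow> bool" where
  "embedded_partition D P \<longleftrightarrow>
     finite P \<and> P \<subseteq> regular_points D \<and>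
     (\<forall>r \<in> connected_components_of
              (subtopology (space_of (circle D)) (points (circle D) - P)).
        properly_embedded D r)"

text \<open>The number of arcs of an embedded partition equals the number of its cut points.\<close>

definition arc_number :: "'p diagram \<Rightarrow> nat" where
  "arc_number D = (LEAST n. \<exists>P. embedded_partition D P \<and> card P = n)"


section \<open>Stars\<close>

definition star_size :: "nat \<Rightarrow> nat \<Rightarrow> nat" where
  "star_size t a = 2 + 2 * (a + 1) * t"

text \<open>Since \<open>cis\<close> has period \<open>2 * pi\<close>, the subscript \<open>j\<close> is automatically taken modulo
  \<open>star_size t a\<close>.\<close>

definition star_point :: "nat \<Rightarrow> nat \<Rightarrow> nat \<Rightarrow> complex" where
  "star_point t a j = cis (2 * pi * real j / real (star_size t a))"

definition star_crossing :: "nat \<Rightarrow> nat \<Rightarrow> nat \<Rightarrow> complex set" where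
  "star_crossing t a j = {star_point t a j, star_point t a (j + 2 * t - 1)}"

text \<open>A representative, for \<open>t \<ge> 1\<close>, in which the subscripts of the
  crossings are even; lemma \<open>rotate_star\<close> shows that odd subscripts give an equivalent diagram.\<close>

definition star :: "nat \<Rightarrow> nat \<Rightarrow> complex diagram" where
  "star t a =
     \<lparr>circle = standard_circle,
      half_crossings = star_point t a ` {0..1 + 2 * (a + 1) * t},
      crossings = {star_crossing t a j | j. j \<in> {0..1 + 2 * (a + 1) * t} \<and> even j}\<rparr>"

lemma star_point_eq_iff:
  "star_point t a j = star_point t a k \<longleftrightarrow> j mod star_size t a = k mod star_size t a"
proof -
  let ?N = "star_size t a"
  have N: "?N > 0" by (simp add: star_size_def)
  have per: "star_point t a i = star_point t a (i mod ?N)" for i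
  proof -
    have "real i = real (i mod ?N) + real ?N * real (i div ?N)"
      by (metis mod_mult_div_eq of_nat_add of_nat_mult)
    hence "2 * pi * real i / real ?N = 2 * pi * real (i mod ?N) / real ?N + 2 * pi * real (i div ?N)"
      using N by (simp add: field_simps)
    thus ?thesis
      by (simp add: star_point_def flip: cis_mult)
  qed
  have "inj_on (star_point t a) {..<?N}"
    using Complex.bij_betw_roots_unity[OF N] by (simp add: bij_betw_def star_point_def[abs_def])
  hence "star_point t a (j mod ?N) = star_point t a (k mod ?N) \<longleftrightarrow> j mod ?N = k mod ?N"
    using N by (auto simp: inj_on_def)
  thus ?thesis using per by metis
qed

lemma chord_diagram_star:
  assumes "t \<ge> 1"
  shows "chord_diagram (star t a)"
proof -
  define N where "N = star_size t a"
  have N: "{0..1 + 2 * (a + 1) * t} = {..<N}" "even N" "2 * t < N"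
    by (auto simp: N_def star_size_def)
  define h where "h = star_point t a"
  define m where "m = 2 * t - 1"
  have m: "odd m" "m < N" using assms N by (auto simp: m_def)
  have heq: "h j = h k \<longleftrightarrow> j mod N = k mod N" for j k
    by (simp add: h_def N_def star_point_eq_iff)
  have hmod: "h j = h (j mod N)" for j by (simp add: heq)
  have c: "star_crossing t a j = {h j, h (j + m)}" for j
    using assms by (simp add: star_crossing_def h_def m_def)
  have par: "h j \<noteq> h (k + m)" if "even j" "even k" for j k
  proof
    assume "h j = h (k + m)"
    hence "j mod N mod 2 = (k + m) mod N mod 2" by (simp add: heq)
    hence "j mod 2 = (k + m) mod 2" using \<open>even N\<close> by (simp add: mod_mod_cancel)
    thus False using that m by presburger
  qed
  have card2: "card (star_crossing t a j) = 2" if "even j" for j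
    using par[OF that that] by (simp add: c)
  have inj: "inj_on h {..<N}" by (auto simp: inj_on_def heq)
  have un: "\<Union> (crossings (star t a)) = h ` {..<N}"
  proof
    show "\<Union> (crossings (star t a)) \<subseteq> h ` {..<N}"
    proof -
      have "h j \<in> h ` {..<N}" for j
        using hmod[of j] N(3) by auto
      thus ?thesis by (auto simp: star_def c)
    qed
    show "h ` {..<N} \<subseteq> \<Union> (crossings (star t a))"
    proof
      fix z assume "z \<in> h ` {..<N}"
      then obtain j where j: "j < N" "z = h j" by auto
      show "z \<in> \<Union> (crossings (star t a))"
      proof (cases "even j")
        case True
        thus ?thesis using j unfolding star_def N(1) c by auto
      next
        case False
        define k where "k = (j + (N - m)) mod N"
        have "k mod 2 = (j + (N - m)) mod 2"
          using N(2) by (simp add: k_def mod_mod_cancel)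
        moreover have "odd (N - m)" using m N(2) by simp
        ultimately have "even k" using False by (metis even_add mod_2_eq_odd odd_add dvd_eq_mod_eq_0)
        moreover have "k < N" using N by (simp add: k_def)
        moreover have "(k + m) mod N = j mod N"
        proof -
          have "(k + m) mod N = (j + (N - m) + m) mod N"
            by (simp add: k_def mod_add_left_eq)
          also have "j + (N - m) + m = j + N" using m by simp
          finally show ?thesis by simp
        qed
        hence "z = h (k + m)" using j by (simp add: heq)
        ultimately show ?thesis unfolding star_def N(1) c by auto
      qed
    qed
  qed
  have disj: "star_crossing t a j = star_crossing t a k"
    if "j < N" "even j" "k < N" "even k" "star_crossing t a j \<inter> star_crossing t a k \<noteq> {}" for j k
  proof -
    have "h j = h k \<or> h (j + m) = h (k + m)"
      using that par[of j k] par[of k j] by (auto simp: c)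
    hence "j mod N = k mod N"
    proof
      assume "h (j + m) = h (k + m)"
      thus ?thesis by (auto simp: heq nat_mod_eq_iff)
    qed (simp add: heq)
    thus ?thesis using that by simp
  qed
  have "partition_on (h ` {..<N}) (crossings (star t a))"
    unfolding partition_on_def
  proof (intro conjI)
    show "disjoint (crossings (star t a))"
      unfolding disjoint_def
    proof (intro ballI impI)
      fix A B assume A: "A \<in> crossings (star t a)" and B: "B \<in> crossings (star t a)" and "A \<noteq> B"
      obtain j where "A = star_crossing t a j" "j < N" "even j"
        using A unfolding star_def N(1) by auto
      moreover obtain k where "B = star_crossing t a k" "k < N" "even k"
        using B unfolding star_def N(1) by auto
      ultimately show "A \<inter> B = {}" using disj \<open>A \<noteq> B\<close> by blast
    qed
  qed (auto simp: un, auto simp: star_def c)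
  moreover have "half_crossings (star t a) = h ` {..<N}"
    using N(1) by (simp add: star_def h_def)
  moreover have "card (h ` {..<N}) = N" using inj by (simp add: card_image)
  moreover have "h ` {..<N} \<subseteq> sphere 0 1" by (auto simp: h_def star_point_def)
  moreover have "\<forall>x\<in>crossings (star t a). card x = 2"
    by (auto simp: star_def card2)
  moreover have "circle (star t a) = standard_circle" by (simp add: star_def)
  moreover have "oriented_circle standard_circle"
    using homeomorphic_map_id[of "top_of_set (sphere (0::complex) 1)" "top_of_set (sphere 0 1)"]
    by (simp add: oriented_circle_def standard_circle_def id_def)
  ultimately show ?thesis
    using N(2) by (simp add: chord_diagram_def standard_circle_def)
qed

lemma rotate_star:
  assumes "t \<ge> 1"
  shows "\<exists>\<phi>. orientation_preserving_homeo standard_circle standard_circle \<phi> \<and>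
     {\<phi> ` x | x. x \<in> crossings (star t a)} =
     {star_crossing t a j | j. j \<in> {0..1 + 2 * (a + 1) * t} \<and> odd j}"
proof -
  let ?\<theta> = "2 * pi / real (star_size t a)"
  let ?\<phi> = "\<lambda>z. cis ?\<theta> * z"
  have "homeomorphic_maps (top_of_set (sphere 0 1)) (top_of_set (sphere 0 1)) ?\<phi> (\<lambda>z. cis (- ?\<theta>) * z)"
    by (auto simp: homeomorphic_maps_def norm_mult cis_mult simp flip: mult.assoc
        intro!: continuous_intros)
  hence "homeomorphic_map (top_of_set (sphere 0 1)) (top_of_set (sphere 0 1)) ?\<phi>"
    using homeomorphic_map_maps by blast
  hence ori: "orientation_preserving_homeo standard_circle standard_circle ?\<phi>"
    unfolding orientation_preserving_homeo_def standard_circle_def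
    by (auto simp: cis_mult strict_mono_def intro!: exI[of _ "\<lambda>s. ?\<theta> + s"] continuous_intros)
  have sp: "?\<phi> (star_point t a j) = star_point t a (Suc j)" for j
    by (simp add: star_point_def cis_mult add_divide_distrib distrib_left)
  have "?\<phi> ` star_crossing t a j = star_crossing t a (Suc j)" for j
    using assms sp by (simp add: star_crossing_def Suc_diff_le)
  hence "{?\<phi> ` x | x. x \<in> crossings (star t a)} =
     {star_crossing t a (Suc j) | j. j \<in> {0..1 + 2 * (a + 1) * t} \<and> even j}"
    by (fastforce simp: star_def)
  also have "\<dots> = {star_crossing t a j | j. j \<in> {0..1 + 2 * (a + 1) * t} \<and> odd j}"
  proof -
    have idx: "(\<exists>j. k = Suc j \<and> j \<in> {0..1 + 2 * (a + 1) * t} \<and> even j) \<longleftrightarrow>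
          k \<in> {0..1 + 2 * (a + 1) * t} \<and> odd k" (is "?L \<longleftrightarrow> ?R") for k
    proof
      assume ?L
      then obtain j where "k = Suc j" "j \<le> 1 + 2 * ((a + 1) * t)" "even j" by auto
      moreover have "j \<noteq> 1 + 2 * ((a + 1) * t)" using \<open>even j\<close> by auto
      ultimately show ?R by auto
    next
      assume ?R
      thus ?L by (intro exI[of _ "k - 1"]) (auto elim: oddE)
    qed
    have "{star_crossing t a (Suc j) | j. j \<in> {0..1 + 2 * (a + 1) * t} \<and> even j} =
          {star_crossing t a k | k. \<exists>j. k = Suc j \<and> j \<in> {0..1 + 2 * (a + 1) * t} \<and> even j}"
      by fast
    thus ?thesis unfolding idx .
  qed
  finally show ?thesis using ori by blast
qed

end

theory Submission
  imports Defs
begin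

text \<open>Record a crossing by the two closed arcs of the circle between its ends. A nonempty finite set of
  regular points is the set of cut points of an embedded partition iff it meets all these arcs
  (lemmas \<open>component_of_cut_circle\<close>, \<open>embedded_partition_if_hits\<close> and
  \<open>connected_contains_no_crossing\<close>). So, with \<open>k = a + 1\<close>, the theorem says that \<open>k\<close> points never
  meet all arcs precisely if the diagram contains a star. Everything is computed in angular coordinates,
  that is, on the real line modulo \<open>2 * pi\<close>.

  A star needs more than \<open>k\<close> cuts by counting: it has \<open>1 + k * t\<close> crossings, and each point of the
  circle lies in at most \<open>t\<close> of the arcs from the half-crossing number \<open>j\<close>, for the given parity of \<open>j\<close>, to number \<open>j + 2 * t - 1\<close>
  (\<open>card_hit_intervals_le\<close>).

  For the converse, place cuts greedily. From a cut at \<open>x\<close> the next one is best placed at \<open>jump x\<close>, the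
  smallest end of an arc that starts at \<open>x\<close> or later. If \<open>k\<close> cuts never suffice, then \<open>k\<close> jumps never
  complete a turn (\<open>jumps_less_period\<close>). The map \<open>jump\<close> is a monotone map of the line that commutes
  with translation by the period and takes finitely many values modulo the period, so it has a periodic
  orbit. Enumerate that orbit increasingly as \<open>y\<close>, with \<open>q\<close> points per period; then \<open>jump\<close> acts on it as a
  shift, \<open>jump (y s) = y (s + p)\<close> (\<open>ex_jump_orbit\<close>), and \<open>k * p < q\<close>. The chord ending at \<open>y (s + p)\<close> starts
  strictly between \<open>y s\<close> and \<open>y (s + 1)\<close>. If it started at \<open>y (s + 1)\<close> or later, \<open>jump\<close> would not be
  injective on the orbit; that it does not start at \<open>y s\<close> uses \<open>k \<ge> 2\<close>, i.e. \<open>a > 0\<close>. These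
  \<open>q\<close> chords thus interleave exactly as in a star, except that \<open>q\<close> may be larger than \<open>k * p + 1\<close>. In
  that case the counting bound shows that one of the chords can be deleted from the diagram without making
  \<open>k\<close> cuts sufficient, and induction on the number of chords applies
  (\<open>star_or_smaller_unhittable\<close>, \<open>star_in_unhittable\<close>). Finally, \<open>q = k * p + 1\<close> gives the star with
  \<open>t = p\<close>, and a piecewise linear change of angles realizes the equivalence (\<open>contains_star_if_lifts\<close>).\<close>

section \<open>Periodic sets of reals\<close>

text \<open>For \<open>\<tau> = 2 * pi\<close> these are all the angles of the points of a circle that have an angle in \<open>Q\<close>.\<close>

definition translates :: "real \<Rightarrow> real set \<Rightarrow> real set" where
  "translates \<tau> Q = {z + of_int n * \<tau> | z (n::int). z \<in> Q}"

text \<open>For positive \<open>\<tau>\<close>, these are the sets \<open>translates \<tau> Q\<close> with \<open>Q\<close> finite. Local finiteness is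
  the form that yields nearest elements.\<close>

definition periodic_discrete :: "real \<Rightarrow> real set \<Rightarrow> bool" where
  "periodic_discrete \<tau> S \<longleftrightarrow>
     0 < \<tau> \<and> (\<forall>x. x + \<tau> \<in> S \<longleftrightarrow> x \<in> S) \<and> (\<forall>a b. finite (S \<inter> {a..b}))"

lemma int_shift_invariant:
  fixes \<tau> :: real
  assumes "\<And>x. P (x + \<tau>) \<longleftrightarrow> P x"
  shows "P (x + of_int n * \<tau>) \<longleftrightarrow> P x"
proof (induction n rule: int_induct[where k = 0])
  case (step1 i)
  then show ?case using assms[of "x + of_int i * \<tau>"] by (simp add: algebra_simps)
next
  case (step2 i)
  then show ?case using assms[of "x + of_int (i - 1) * \<tau>"] by (simp add: algebra_simps)
qed simp

lemma periodic_discrete_shift: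
  assumes "periodic_discrete \<tau> S"
  shows "x + of_int n * \<tau> \<in> S \<longleftrightarrow> x \<in> S"
  using assms int_shift_invariant[of "\<lambda>x. x \<in> S"] by (simp add: periodic_discrete_def)

lemma translates_shift:
  "x + of_int n * \<tau> \<in> translates \<tau> Q \<longleftrightarrow> x \<in> translates \<tau> Q"
proof (rule int_shift_invariant[of "\<lambda>x. x \<in> translates \<tau> Q"])
  fix x
  have "x + \<tau> = z + of_int n * \<tau> \<longleftrightarrow> x = z + of_int (n - 1) * \<tau>" for z and n :: int
    by (auto simp: algebra_simps)
  moreover have "(\<exists>n::int. x = z + of_int (n - 1) * \<tau>) \<longleftrightarrow> (\<exists>n::int. x = z + of_int n * \<tau>)" for z
    by (metis diff_add_cancel add_diff_cancel)
  ultimately show "x + \<tau> \<in> translates \<tau> Q \<longleftrightarrow> x \<in> translates \<tau> Q"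
    unfolding translates_def mem_Collect_eq by (metis (no_types))
qed

lemma subset_translates: "Q \<subseteq> translates \<tau> Q"
  by (force simp: translates_def intro: exI[of _ "0::int"])

lemma window_representative:
  fixes \<tau> :: real
  assumes "0 < \<tau>"
  obtains n :: int where "a \<le> x + of_int n * \<tau>" "x + of_int n * \<tau> < a + \<tau>"
proof
  have "of_int \<lfloor>(x - a) / \<tau>\<rfloor> \<le> (x - a) / \<tau>" "(x - a) / \<tau> < of_int \<lfloor>(x - a) / \<tau>\<rfloor> + 1"
    by linarith+
  then have "of_int \<lfloor>(x - a) / \<tau>\<rfloor> * \<tau> \<le> x - a" "x - a < (of_int \<lfloor>(x - a) / \<tau>\<rfloor> + 1) * \<tau>"
    using assms by (simp_all only: pos_le_divide_eq pos_divide_less_eq)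
  then show "a \<le> x + of_int (- \<lfloor>(x - a) / \<tau>\<rfloor>) * \<tau>" "x + of_int (- \<lfloor>(x - a) / \<tau>\<rfloor>) * \<tau> < a + \<tau>"
    by (simp_all add: algebra_simps)
qed

lemma periodic_discrete_translates:
  assumes "0 < \<tau>" "finite Q"
  shows "periodic_discrete \<tau> (translates \<tau> Q)"
  unfolding periodic_discrete_def
proof (intro conjI allI)
  show "x + \<tau> \<in> translates \<tau> Q \<longleftrightarrow> x \<in> translates \<tau> Q" for x
    using translates_shift[of x 1] by simp
  fix a b
  have "translates \<tau> Q \<inter> {a..b} \<subseteq>
      (\<Union>z\<in>Q. (\<lambda>n::int. z + of_int n * \<tau>) ` {\<lfloor>(a - z) / \<tau>\<rfloor>..\<lceil>(b - z) / \<tau>\<rceil>})"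
  proof
    fix s assume "s \<in> translates \<tau> Q \<inter> {a..b}"
    then obtain z and n :: int where z: "z \<in> Q" "s = z + of_int n * \<tau>" "a \<le> s" "s \<le> b"
      by (auto simp: translates_def)
    then have "(a - z) / \<tau> \<le> of_int n" "of_int n \<le> (b - z) / \<tau>"
      using assms by (simp_all add: field_simps)
    then have "n \<in> {\<lfloor>(a - z) / \<tau>\<rfloor>..\<lceil>(b - z) / \<tau>\<rceil>}"
      by (simp add: floor_le_iff le_ceiling_iff; linarith)
    with z show "s \<in> (\<Union>z\<in>Q. (\<lambda>n::int. z + of_int n * \<tau>) ` {\<lfloor>(a - z) / \<tau>\<rfloor>..\<lceil>(b - z) / \<tau>\<rceil>})"
      by blast
  qed
  then show "finite (translates \<tau> Q \<inter> {a..b})"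
    by (rule finite_subset) (use assms in auto)
qed (use assms in auto)

lemma quasi_periodic_shift:
  fixes y :: "int \<Rightarrow> real" and q :: nat
  assumes "\<And>s. y (s + int q) = y s + \<tau>"
  shows "y (s + n * int q) = y s + of_int n * \<tau>"
proof (induction n rule: int_induct[where k = 0])
  case (step1 i)
  then show ?case using assms[of "s + i * int q"] by (simp add: algebra_simps)
next
  case (step2 i)
  then show ?case using assms[of "s + (i - 1) * int q"] by (simp add: algebra_simps)
qed simp

text \<open>Cuts have to avoid the half-crossings. A cut "at \<open>y\<close>" is therefore always placed slightly
  below \<open>y\<close>, close enough for the gap to contain no half-crossing.\<close>

lemma ex_gap_below:
  assumes "periodic_discrete \<tau> S"
  shows "\<exists>c<y. S \<inter> {c..<y} = {}"
proof -
  define A where "A = insert (y - 1) (S \<inter> {y - 1..y} \<inter> {..<y})"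
  have A: "finite A" "A \<noteq> {}" "\<forall>x\<in>A. x < y"
    using assms by (auto simp: A_def periodic_discrete_def)
  define c where "c = (Max A + y) / 2"
  have "Max A < y" using A by simp
  then have c: "Max A < c" "c < y" by (auto simp: c_def)
  have "y - 1 \<le> Max A" using A by (intro Max_ge) (auto simp: A_def)
  have "s \<notin> S" if "c \<le> s" "s < y" for s
  proof
    assume "s \<in> S"
    then have "s \<in> A" using that c \<open>y - 1 \<le> Max A\<close> by (auto simp: A_def)
    then show False using Max_ge[of A s] A c that by linarith
  qed
  with c show ?thesis by (intro exI[of _ c]) auto
qed

lemma ex_nearest_below:
  assumes "periodic_discrete \<tau> S" "S \<noteq> {}"
  obtains \<alpha> where "\<alpha> \<in> S" "\<alpha> \<le> x" "S \<inter> {\<alpha><..x} = {}"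
proof -
  obtain z where "z \<in> S" using assms by auto
  have "0 < \<tau>" using assms by (simp add: periodic_discrete_def)
  then obtain n :: int where n: "x - \<tau> \<le> z + of_int n * \<tau>" "z + of_int n * \<tau> < x"
    using window_representative[of \<tau> "x - \<tau>" z] by auto
  define A where "A = S \<inter> {x - \<tau>..x}"
  have A: "finite A" "A \<noteq> {}"
    using assms n periodic_discrete_shift[OF assms(1), of z n] \<open>z \<in> S\<close>
    by (auto simp: A_def periodic_discrete_def)
  have "S \<inter> {Max A<..x} = {}"
  proof (rule ccontr)
    assume "S \<inter> {Max A<..x} \<noteq> {}"
    then obtain s where s: "s \<in> S" "Max A < s" "s \<le> x" by auto
    have "x - \<tau> \<le> Max A" using Max_in[OF A] by (auto simp: A_def)
    then have "s \<in> A" using s by (auto simp: A_def)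
    then show False using Max_ge[of A s] A s by linarith
  qed
  moreover have "Max A \<in> S" "Max A \<le> x" using Max_in[OF A] by (auto simp: A_def)
  ultimately show thesis using that by blast
qed

text \<open>One period is listed in increasing order, and division with remainder by the length \<open>q\<close> of
  that list extends the list to all integers.\<close>

lemma periodic_enumeration:
  assumes "periodic_discrete \<tau> S" "S \<noteq> {}"
  obtains y :: "int \<Rightarrow> real" and q :: nat
  where "0 < q" "strict_mono y" "range y = S" "\<And>s. y (s + int q) = y s + \<tau>"
proof -
  have \<tau>: "0 < \<tau>" using assms by (simp add: periodic_discrete_def)
  define W where "W = S \<inter> {0..<\<tau>}"
  have "W \<subseteq> S \<inter> {0..\<tau>}" by (auto simp: W_def)
  moreover have "finite (S \<inter> {0..\<tau>})" using assms by (simp add: periodic_discrete_def)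
  ultimately have fin: "finite W" by (rule finite_subset)
  obtain z where "z \<in> S" using assms by auto
  obtain n :: int where "0 \<le> z + of_int n * \<tau>" "z + of_int n * \<tau> < 0 + \<tau>"
    using window_representative[OF \<tau>] by blast
  then have "W \<noteq> {}"
    using \<open>z \<in> S\<close> periodic_discrete_shift[OF assms(1), of z n] by (auto simp: W_def)
  define xs where "xs = sorted_list_of_set W"
  define q where "q = length xs"
  have xs: "sorted_wrt (<) xs" "set xs = W" using fin by (auto simp: xs_def)
  have q: "0 < q" using xs \<open>W \<noteq> {}\<close> by (auto simp: q_def)
  define y where "y i = xs ! nat (i mod int q) + of_int (i div int q) * \<tau>" for i
  have idx: "nat (i mod int q) < q" for i
    using q by (simp add: nat_less_iff)
  have inW: "xs ! nat (i mod int q) \<in> W" for i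
    using idx xs(2) by (auto simp: q_def)
  have "y i < y j" if "i < j" for i j
  proof (cases "i div int q = j div int q")
    case True
    then have "i mod int q < j mod int q"
      using that by (metis add_less_cancel_left mult_div_mod_eq)
    then have "nat (i mod int q) < nat (j mod int q)"
      using q by (subst nat_less_eq_zless) simp_all
    then show ?thesis
      using sorted_wrt_nth_less[OF xs(1)] idx True by (auto simp: y_def q_def)
  next
    case False
    then have "i div int q + 1 \<le> j div int q"
      using that q zdiv_mono1[of i j "int q"] by linarith
    then have "of_int (i div int q) + 1 \<le> (of_int (j div int q) :: real)" by linarith
    then have "of_int (i div int q) * \<tau> + \<tau> \<le> of_int (j div int q) * \<tau>"
      using \<tau> mult_right_mono[of "of_int (i div int q) + 1" "of_int (j div int q)" \<tau>]
      by (simp add: algebra_simps)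
    then show ?thesis using inW[of i] inW[of j] by (auto simp: y_def W_def)
  qed
  then have "strict_mono y" by (simp add: strict_mono_def)
  moreover have "range y = S"
  proof
    show "range y \<subseteq> S"
      using inW periodic_discrete_shift[OF assms(1)] by (auto simp: y_def W_def)
    show "S \<subseteq> range y"
    proof
      fix s assume "s \<in> S"
      obtain n :: int where n: "0 \<le> s + of_int n * \<tau>" "s + of_int n * \<tau> < 0 + \<tau>"
        using window_representative[OF \<tau>] by blast
      then have "s + of_int n * \<tau> \<in> set xs"
        using \<open>s \<in> S\<close> xs periodic_discrete_shift[OF assms(1), of s n] by (auto simp: W_def)
      then obtain i where i: "i < q" "xs ! i = s + of_int n * \<tau>"
        by (auto simp: in_set_conv_nth q_def)
      have "(int i + (- n) * int q) div int q = - n"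
        using div_mult_self1[of "int q" "int i" "- n"] i q by simp
      moreover have "(int i + (- n) * int q) mod int q = int i"
        using mod_mult_self1[of "int i" "- n" "int q"] i by simp
      ultimately have "y (int i + (- n) * int q) = s"
        unfolding y_def using i by (simp only: nat_int)
      then show "s \<in> range y" by (metis rangeI)
    qed
  qed
  moreover have "y (s + int q) = y s + \<tau>" for s
    using q by (simp add: y_def algebra_simps)
  ultimately show thesis using that q by blast
qed

section \<open>Chords lifted to the real line\<close>

text \<open>A cut set splits a crossing iff each of the two closed arcs between its ends contains a cut
  point. Lifted to the line, this says that the cut set meets every interval \<open>{u..v}\<close> coming from
  a crossing, up to translation by the period.\<close>

definition hits :: "real \<Rightarrow> real set \<Rightarrow> real \<Rightarrow> real \<Rightarrow> bool" where
  "hits \<tau> Q u v \<longleftrightarrow> translates \<tau> Q \<inter> {u..v} \<noteq> {}"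

text \<open>The combinatorial form of "no embedded partition has at most \<open>k\<close> arcs". The set \<open>L\<close> of
  forbidden cut positions is a separate parameter, so that it can stay the same while chords
  are removed from \<open>E\<close>.\<close>

definition unhittable :: "real \<Rightarrow> real set \<Rightarrow> nat \<Rightarrow> (real \<times> real) set \<Rightarrow> bool" where
  "unhittable \<tau> L k E \<longleftrightarrow>
     (\<forall>Q. finite Q \<and> Q \<inter> L = {} \<and> (\<forall>(u, v)\<in>E. hits \<tau> Q u v) \<longrightarrow> k < card Q)"

text \<open>The counting bound behind both directions of the theorem. On the line, a point \<open>z\<close> with
  \<open>y a \<le> z < y (a + 1)\<close> lies in exactly the \<open>p\<close> intervals \<open>{y s..<y (s + p)}\<close> with
  \<open>a - p < s \<le> a\<close>. Modulo the period, one cut therefore accounts for at most \<open>p\<close> of the intervals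
  with \<open>0 \<le> s < q\<close>, and a star, which consists of \<open>1 + (a + 1) * p\<close> such intervals, needs more
  than \<open>a + 1\<close> cuts.\<close>

lemma card_hit_intervals_le:
  fixes y :: "int \<Rightarrow> real" and q p :: nat
  assumes \<tau>: "0 < \<tau>" and q: "0 < q" and y: "strict_mono y" "\<And>s. y (s + int q) = y s + \<tau>"
    and Q: "finite Q" and S: "S \<subseteq> {0..<int q}"
    and hit: "\<And>s. s \<in> S \<Longrightarrow> translates \<tau> Q \<inter> {y s..<y (s + int p)} \<noteq> {}"
  shows "card S \<le> p * card Q"
proof -
  note yq = quasi_periodic_shift[of y q, OF y(2)]
  \<comment> \<open>For each point, the last index at or below it bounds the indices of the intervals around it.\<close>
  have "\<exists>a. \<forall>s. y s \<le> z \<and> z < y (s + int p) \<longrightarrow> a - int p < s \<and> s \<le> a" for z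
  proof -
    define A where "A = {s. y s \<le> z}"
    obtain n :: int where n: "z \<le> y 0 + of_int n * \<tau>" "y 0 + of_int n * \<tau> < z + \<tau>"
      using window_representative[OF \<tau>] by blast
    have A1: "s < n * int q + 1" if "s \<in> A" for s
    proof (rule ccontr)
      assume "\<not> s < n * int q + 1"
      then have "y (0 + n * int q) < y s" using y(1) by (simp add: strict_mono_less)
      then show False using that n yq[of 0 n] by (simp add: A_def)
    qed
    have "y (0 + (n - 1) * int q) \<le> z" using n yq[of 0 "n - 1"] by (simp add: algebra_simps)
    then have A2: "(n - 1) * int q \<in> A" by (simp add: A_def)
    define B where "B = A \<inter> {(n - 1) * int q..n * int q}"
    have B: "finite B" "B \<noteq> {}" using A2 by (auto simp: B_def algebra_simps)
    define a where "a = Max B"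
    have a: "a \<in> A" "(n - 1) * int q \<le> a" using Max_in[OF B] by (auto simp: a_def B_def)
    have le: "s \<le> a" if "s \<in> A" for s
    proof (cases "(n - 1) * int q \<le> s")
      case True
      then have "s \<in> B" using A1 that by (force simp: B_def)
      then show ?thesis using B by (simp add: a_def)
    qed (use a in linarith)
    have "a - int p < s" if "z < y (s + int p)" for s
    proof -
      have "y a < y (s + int p)" using a that by (simp add: A_def)
      then show ?thesis using y(1) by (simp add: strict_mono_less)
    qed
    then show ?thesis using le by (intro exI[of _ a]) (auto simp: A_def)
  qed
  then obtain a where a: "\<And>z s. y s \<le> z \<Longrightarrow> z < y (s + int p) \<Longrightarrow> a z - int p < s \<and> s \<le> a z"
    by metis
  have "\<exists>z n. z \<in> Q \<and> y s \<le> z + of_int n * \<tau> \<and> z + of_int n * \<tau> < y (s + int p)"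
    if "s \<in> S" for s
    using hit[OF that] by (force simp: translates_def)
  then obtain z n where zn: "\<And>s. s \<in> S \<Longrightarrow> z s \<in> Q \<and> y s \<le> z s + of_int (n s) * \<tau>
      \<and> z s + of_int (n s) * \<tau> < y (s + int p)"
    by metis
  \<comment> \<open>An interval is recorded by the cut that hits it and by its index after moving that hit back to the cut itself.\<close>
  define f where "f s = (z s, s - n s * int q)" for s
  have "f s \<in> (SIGMA x:Q. {a x - int p<..a x})" if "s \<in> S" for s
  proof -
    have "y (s - n s * int q) \<le> z s" "z s < y (s - n s * int q + int p)"
      using zn[OF that] yq[of s "- n s"] yq[of "s + int p" "- n s"] by (simp_all add: algebra_simps)
    then show ?thesis using a zn[OF that] by (auto simp: f_def)
  qed
  moreover have "inj_on f S"
  proof (rule inj_onI)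
    fix s s' assume ss: "s \<in> S" "s' \<in> S" "f s = f s'"
    then have "s mod int q = s' mod int q"
      by (metis f_def prod.inject mod_mult_self1 diff_add_cancel)
    moreover have "s \<in> {0..<int q}" "s' \<in> {0..<int q}" using ss S by blast+
    ultimately show "s = s'" by simp
  qed
  moreover have "finite (SIGMA x:Q. {a x - int p<..a x})" using Q by auto
  ultimately have "card S \<le> card (SIGMA x:Q. {a x - int p<..a x})"
    by (intro card_inj_on_le[of f]) blast+
  also have "\<dots> = p * card Q" using Q by (simp add: card_SigmaI)
  finally show ?thesis .
qed

text \<open>Each crossing appears in \<open>E\<close> as two classes of intervals modulo \<open>\<tau>\<close>, one for each arc
  between its ends; \<open>flip_iff\<close> exchanges them, and applied twice it gives periodicity.\<close>

locale lifted_chords =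
  fixes \<tau> :: real and L :: "real set" and E :: "(real \<times> real) set"
  assumes L: "periodic_discrete \<tau> L"
    and chord_bounds: "(u, v) \<in> E \<Longrightarrow> u < v \<and> v < u + \<tau>"
    and flip_iff: "(v, u + \<tau>) \<in> E \<longleftrightarrow> (u, v) \<in> E"
    and chord_unique: "(u, v) \<in> E \<Longrightarrow> (u, v') \<in> E \<Longrightarrow> v = v'"
    and start_in_L: "(u, v) \<in> E \<Longrightarrow> u \<in> L"
begin

lemma period_pos: "0 < \<tau>"
  using L by (simp add: periodic_discrete_def)

lemma end_in_L: "(u, v) \<in> E \<Longrightarrow> v \<in> L"
  using flip_iff start_in_L by blast

lemma chord_shift: "(u + of_int n * \<tau>, v + of_int n * \<tau>) \<in> E \<longleftrightarrow> (u, v) \<in> E"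
proof -
  have "(x + \<tau>, (x + \<tau>) + (v - u)) \<in> E \<longleftrightarrow> (x, x + (v - u)) \<in> E" for x
  proof -
    have "(x + \<tau>) + (v - u) = (x + (v - u)) + \<tau>" by simp
    then show ?thesis
      using flip_iff[of "x + (v - u)" x] flip_iff[of "x + \<tau>" "x + (v - u)"] by metis
  qed
  from int_shift_invariant[of "\<lambda>x. (x, x + (v - u)) \<in> E", OF this, of u n]
  show ?thesis by (simp add: algebra_simps)
qed

lemma chord_start_unique:
  assumes "(u, v) \<in> E" "(u', v) \<in> E"
  shows "u = u'"
  using chord_unique[of v "u + \<tau>" "u' + \<tau>"] assms flip_iff by simp

lemma finite_chords_from:
  "finite {e \<in> E. a \<le> fst e \<and> fst e \<le> b}"
proof (rule finite_imageD)
  show "finite (fst ` {e \<in> E. a \<le> fst e \<and> fst e \<le> b})"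
    by (rule finite_subset[of _ "L \<inter> {a..b}"])
       (use L start_in_L in \<open>auto simp: periodic_discrete_def\<close>)
  show "inj_on fst {e \<in> E. a \<le> fst e \<and> fst e \<le> b}"
    using chord_unique by (auto simp: inj_on_def)
qed

text \<open>Among the chords starting at \<open>x\<close> or later, one with the smallest end. A cut just below \<open>x\<close>
  being given, the next cut may be postponed until just below \<open>jump x\<close>, and no further: \<open>jump\<close> is the
  greedy step. The minimum exists because translating back by periods reduces to the finitely
  many chords that start within one period after \<open>x\<close>.\<close>

definition first_chord :: "real \<Rightarrow> real \<times> real" where
  "first_chord x = (SOME e. e \<in> E \<and> x \<le> fst e \<and> (\<forall>e'\<in>E. x \<le> fst e' \<longrightarrow> snd e \<le> snd e'))"

abbreviation "from_pt x \<equiv> fst (first_chord x)"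
abbreviation "jump x \<equiv> snd (first_chord x)"

end

locale nonempty_lifted_chords = lifted_chords +
  assumes E_nonempty: "E \<noteq> {}"
begin

lemma first_chord:
  "first_chord x \<in> E" "x \<le> from_pt x" "(u, v) \<in> E \<Longrightarrow> x \<le> u \<Longrightarrow> jump x \<le> v"
proof -
  define A where "A = {e \<in> E. x \<le> fst e \<and> fst e \<le> x + \<tau>}"
  have A: "finite A" unfolding A_def by (rule finite_chords_from)
  have rep: "\<exists>e'\<in>A. snd e' \<le> snd e" if "e \<in> E" "x \<le> fst e" for e
  proof (cases "fst e \<le> x + \<tau>")
    case False
    obtain n :: int where n: "x \<le> fst e + of_int n * \<tau>" "fst e + of_int n * \<tau> < x + \<tau>"
      using window_representative[OF period_pos] by blast
    have "(fst e + of_int n * \<tau>, snd e + of_int n * \<tau>) \<in> A"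
      using that n chord_shift[of "fst e" n "snd e"] by (auto simp: A_def)
    moreover have "of_int n * \<tau> \<le> 0" using n False by linarith
    ultimately show ?thesis by (intro bexI) auto
  next
    case True
    then show ?thesis using that by (intro bexI[of _ e]) (auto simp: A_def)
  qed
  obtain e where "e \<in> E" using E_nonempty by auto
  obtain n :: int where n: "x \<le> fst e + of_int n * \<tau>" "fst e + of_int n * \<tau> < x + \<tau>"
    using window_representative[OF period_pos] by blast
  have "(fst e + of_int n * \<tau>, snd e + of_int n * \<tau>) \<in> A"
    using \<open>e \<in> E\<close> n chord_shift[of "fst e" n "snd e"] by (auto simp: A_def)
  then have "A \<noteq> {}" by auto
  then obtain m where m: "m \<in> A" "\<forall>e\<in>A. snd m \<le> snd e"
    using A arg_min_least[OF A, of _ snd] arg_min_if_finite[OF A, of snd] by (metis ex_in_conv)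
  have "\<exists>e. e \<in> E \<and> x \<le> fst e \<and> (\<forall>e'\<in>E. x \<le> fst e' \<longrightarrow> snd e \<le> snd e')"
    using m rep by (intro exI[of _ m]) (force simp: A_def)
  from someI_ex[OF this]
  have *: "first_chord x \<in> E" "x \<le> from_pt x" "\<forall>e'\<in>E. x \<le> fst e' \<longrightarrow> jump x \<le> snd e'"
    by (auto simp: first_chord_def)
  then show "first_chord x \<in> E" "x \<le> from_pt x" by auto
  show "jump x \<le> v" if "(u, v) \<in> E" "x \<le> u" using * that by force
qed

lemma first_chord_pair: "(from_pt x, jump x) \<in> E"
  using first_chord(1) by simp

lemma from_pt_less_jump: "from_pt x < jump x"
  using first_chord_pair chord_bounds by blast

lemma less_jump: "x < jump x"
  using from_pt_less_jump[of x] first_chord(2)[of x] by linarith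

lemma mono_jump: "x \<le> y \<Longrightarrow> jump x \<le> jump y"
  using first_chord(3)[OF first_chord_pair[of y]] first_chord(2)[of y] by force

lemma jump_shift: "jump (x + of_int n * \<tau>) = jump x + of_int n * \<tau>"
proof (rule antisym)
  have "(from_pt x + of_int n * \<tau>, jump x + of_int n * \<tau>) \<in> E"
    using chord_shift first_chord_pair by simp
  then show "jump (x + of_int n * \<tau>) \<le> jump x + of_int n * \<tau>"
    using first_chord by force
  let ?x = "x + of_int n * \<tau>"
  have "(from_pt ?x + of_int (- n) * \<tau>, jump ?x + of_int (- n) * \<tau>) \<in> E"
    using chord_shift first_chord_pair by blast
  moreover have "x \<le> from_pt ?x + of_int (- n) * \<tau>"
    using first_chord(2)[of ?x] by simp
  ultimately have "jump x \<le> jump ?x + of_int (- n) * \<tau>" using first_chord(3) by blast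
  then show "jump x + of_int n * \<tau> \<le> jump ?x" by simp
qed

lemma from_pt_shift: "from_pt (x + of_int n * \<tau>) = from_pt x + of_int n * \<tau>"
proof -
  have "(from_pt x + of_int n * \<tau>, jump (x + of_int n * \<tau>)) \<in> E"
    using chord_shift first_chord_pair by (simp add: jump_shift)
  then show ?thesis using first_chord_pair chord_start_unique by blast
qed

lemma jump_in_L: "jump x \<in> L"
  using first_chord_pair end_in_L by blast

lemma jumps_shift: "(jump ^^ i) (x + of_int n * \<tau>) = (jump ^^ i) x + of_int n * \<tau>"
  by (induction i) (simp_all add: jump_shift)

text \<open>If \<open>k\<close> jumps led once around the circle, then cuts just below the first \<open>k\<close> points of the
  greedy sequence would hit every chord: a chord starting between two successive points of the sequence
  ends no earlier than the second of them.\<close>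

lemma jumps_less_period:
  assumes "unhittable \<tau> L k E"
  shows "(jump ^^ k) x < x + \<tau>"
proof (rule ccontr)
  assume far: "\<not> (jump ^^ k) x < x + \<tau>"
  have "\<exists>c<y. L \<inter> {c..<y} = {}" for y by (rule ex_gap_below[OF L])
  then obtain c where c: "\<And>y. c y < y" "\<And>y s. s \<in> L \<Longrightarrow> c y \<le> s \<Longrightarrow> y \<le> s"
    by (metis atLeastLessThan_iff disjoint_iff not_le)
  define Q where "Q = (\<lambda>i. c ((jump ^^ i) x)) ` {..<k}"
  have "finite Q" "Q \<inter> L = {}" using c by (auto simp: Q_def dest: leD)
  have "k \<noteq> 0" using far period_pos by (auto intro: ccontr)
  have hit0: "hits \<tau> Q u v" if uv: "(u, v) \<in> E" "x \<le> u" "u < x + \<tau>" for u v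
  proof -
    \<comment> \<open>the last point of the greedy sequence at or below the start of the chord\<close>
    define i where "i = (GREATEST i. (jump ^^ i) x \<le> u)"
    have bd: "i < k" if "(jump ^^ i) x \<le> u" for i
    proof (rule ccontr)
      assume "\<not> i < k"
      moreover have "(jump ^^ k) x \<le> (jump ^^ (k + d)) x" for d
        by (induction d) (auto intro: order.trans less_imp_le[OF less_jump])
      ultimately have "(jump ^^ k) x \<le> (jump ^^ i) x" by (metis le_add_diff_inverse not_less)
      then show False using that uv far by linarith
    qed
    then have bd': "i \<le> k" if "(jump ^^ i) x \<le> u" for i using that by (auto intro: less_imp_le)
    have i: "(jump ^^ i) x \<le> u"
      unfolding i_def by (rule GreatestI_nat[where k = 0 and b = k, OF _ bd']) (use uv in simp)
    have Suc_i: "u < (jump ^^ Suc i) x"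
    proof (rule ccontr)
      assume "\<not> ?thesis"
      then have "Suc i \<le> i"
        unfolding i_def by (intro Greatest_le_nat[where b = k, OF _ bd']) (simp_all add: i_def)
      then show False by simp
    qed
    have v: "(jump ^^ Suc i) x \<le> v" using first_chord(3)[OF uv(1) i] by simp
    show ?thesis
    proof (cases "Suc i < k")
      case True
      have "u \<le> c ((jump ^^ Suc i) x)"
        using c(2)[OF start_in_L[OF uv(1)], of "(jump ^^ Suc i) x"] Suc_i by linarith
      moreover have "c ((jump ^^ Suc i) x) \<le> v" using c(1)[of "(jump ^^ Suc i) x"] v by linarith
      moreover have "c ((jump ^^ Suc i) x) \<in> translates \<tau> Q"
        by (rule subsetD[OF subset_translates]) (use True in \<open>auto simp: Q_def simp del: funpow.simps\<close>)
      ultimately show ?thesis by (auto simp: hits_def)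
    next
      case False
      then have "Suc i = k" using bd[OF i] by simp
      then have "x + \<tau> \<le> v" using v far by simp
      \<comment> \<open>The sequence is past a full period, so the first cut, moved on by one period, is the one to use.\<close>
      have "u - \<tau> \<in> L" using start_in_L[OF uv(1)] periodic_discrete_shift[OF L, of u "- 1"] by simp
      then have "u \<le> c x + \<tau>" using c(2)[of "u - \<tau>" x] uv(3) by force
      moreover have "c x + \<tau> \<le> v" using c(1)[of x] \<open>x + \<tau> \<le> v\<close> by linarith
      moreover have "c x \<in> translates \<tau> Q"
        using \<open>k \<noteq> 0\<close> subset_translates[of Q \<tau>] by (force simp: Q_def)
      then have "c x + \<tau> \<in> translates \<tau> Q" using translates_shift[of "c x" 1] by simp
      ultimately show ?thesis by (auto simp: hits_def)
    qed
  qed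
  have "hits \<tau> Q u v" if "(u, v) \<in> E" for u v
  proof -
    obtain n :: int where n: "x \<le> u + of_int n * \<tau>" "u + of_int n * \<tau> < x + \<tau>"
      using window_representative[OF period_pos] by blast
    then have "hits \<tau> Q (u + of_int n * \<tau>) (v + of_int n * \<tau>)"
      using hit0 that chord_shift by blast
    then obtain s where s: "s \<in> translates \<tau> Q" "u + of_int n * \<tau> \<le> s" "s \<le> v + of_int n * \<tau>"
      by (auto simp: hits_def)
    then have "s + of_int (- n) * \<tau> \<in> translates \<tau> Q \<inter> {u..v}"
      using translates_shift[of s "- n"] by auto
    then show ?thesis by (auto simp: hits_def)
  qed
  then have "k < card Q"
    using assms \<open>finite Q\<close> \<open>Q \<inter> L = {}\<close> by (auto simp: unhittable_def)
  moreover have "card Q \<le> k" unfolding Q_def using card_image_le[of "{..<k}"] by simp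
  ultimately show False by simp
qed

end

section \<open>Periodic orbits of the greedy step\<close>

lemma strict_mono_surj_int_is_shift:
  fixes f :: "int \<Rightarrow> int"
  assumes "strict_mono f" "surj f"
  shows "f s = s + f 0"
proof -
  have step: "f (s + 1) = f s + 1" for s
  proof -
    obtain r where r: "f r = f s + 1" using assms(2) by (metis surjD)
    then have "s < r" using strict_mono_less[OF assms(1), of s r] by linarith
    moreover have "r < s + 2"
    proof (rule ccontr)
      assume "\<not> r < s + 2"
      then have "f (s + 1) < f r" using assms(1) by (simp add: strict_mono_def)
      moreover have "f s < f (s + 1)" using assms(1) by (simp add: strict_mono_def)
      ultimately show False using r by linarith
    qed
    ultimately have "r = s + 1" by linarith
    then show ?thesis using r by simp
  qed
  show ?thesis
  proof (induction s rule: int_induct[where k = 0])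
    case (step2 i)
    then show ?case using step[of "i - 1"] by simp
  qed (simp_all add: step)
qed

context nonempty_lifted_chords
begin

text \<open>Jumps land in \<open>L\<close>, which has finitely many classes modulo the period, so two points of
  a greedy sequence agree modulo the period.\<close>

lemma ex_periodic_jump:
  obtains x :: real and m :: int and q :: nat
  where "0 < q" "(jump ^^ q) x = x + of_int m * \<tau>"
proof -
  define r where "r x = x - of_int \<lfloor>x / \<tau>\<rfloor> * \<tau>" for x
  have r: "0 \<le> r x" "r x \<le> \<tau>" for x
  proof -
    have "of_int \<lfloor>x / \<tau>\<rfloor> \<le> x / \<tau>" "x / \<tau> \<le> of_int \<lfloor>x / \<tau>\<rfloor> + 1" by linarith+
    then have "of_int \<lfloor>x / \<tau>\<rfloor> * \<tau> \<le> x" "x \<le> (of_int \<lfloor>x / \<tau>\<rfloor> + 1) * \<tau>"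
      using period_pos by (simp_all only: pos_le_divide_eq pos_divide_le_eq)
    then show "0 \<le> r x" "r x \<le> \<tau>" by (simp_all add: r_def algebra_simps)
  qed
  define f where "f i = r ((jump ^^ Suc i) 0)" for i
  have "f i \<in> L \<inter> {0..\<tau>}" for i
    using r jump_in_L[of "(jump ^^ i) 0"] 
      periodic_discrete_shift[OF L, of "(jump ^^ Suc i) 0" "- \<lfloor>(jump ^^ Suc i) 0 / \<tau>\<rfloor>"]
    by (simp add: f_def r_def)
  then have "range f \<subseteq> L \<inter> {0..\<tau>}" by auto
  moreover have "finite (L \<inter> {0..\<tau>})" using L by (simp add: periodic_discrete_def)
  ultimately have "finite (range f)" by (rule finite_subset)
  then have "\<not> inj f" using finite_imageD by blast
  then obtain i j where "i < j" "f i = f j"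
    by (metis injI linorder_neqE_nat)
  define x where "x = (jump ^^ Suc i) 0"
  have "(jump ^^ (j - i)) x = (jump ^^ Suc j) 0"
    using \<open>i < j\<close> by (simp add: x_def flip: funpow_add comp_apply[of "jump ^^ (j - i)" "jump ^^ Suc i"] del: funpow.simps comp_apply)
  also have "\<dots> = x + of_int (\<lfloor>(jump ^^ Suc j) 0 / \<tau>\<rfloor> - \<lfloor>x / \<tau>\<rfloor>) * \<tau>"
    using \<open>f i = f j\<close> by (simp add: f_def r_def x_def algebra_simps del: funpow.simps)
  finally show thesis using that[of "j - i"] \<open>i < j\<close> by (metis zero_less_diff)
qed

text \<open>On the orbit of a point that returns to itself modulo the period, \<open>jump\<close> is injective and onto. It
  also preserves the order, so in the enumeration \<open>y\<close> of the orbit it can only be a shift of the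
  indices. This is what produces the regular pattern of a star.\<close>

lemma ex_jump_orbit:
  obtains y :: "int \<Rightarrow> real" and q :: nat and p :: int
  where "0 < q" "strict_mono y" "\<And>s. y (s + int q) = y s + \<tau>" "\<And>s. jump (y s) = y (s + p)"
proof -
  obtain x and m :: int and Q :: nat where Q: "0 < Q" "(jump ^^ Q) x = x + of_int m * \<tau>"
    using ex_periodic_jump by metis
  define X where "X = (\<lambda>i. (jump ^^ i) x) ` {..<Q}"
  define Orb where "Orb = translates \<tau> X"
  have "X \<noteq> {}" "finite X" using Q by (auto simp: X_def)
  then have Orb: "periodic_discrete \<tau> Orb" "Orb \<noteq> {}"
    using periodic_discrete_translates[OF period_pos] subset_translates[of X \<tau>] by (auto simp: Orb_def)
  have return: "(jump ^^ Q) y = y + of_int m * \<tau>" if yOrb: "y \<in> Orb" for y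
  proof -
    obtain i and n :: int where y: "y = (jump ^^ i) x + of_int n * \<tau>"
      using yOrb unfolding Orb_def X_def translates_def by blast
    have "(jump ^^ Q) ((jump ^^ i) x) = (jump ^^ i) ((jump ^^ Q) x)"
      by (metis add.commute funpow_add comp_apply)
    then show ?thesis unfolding y jumps_shift by (simp add: Q jumps_shift)
  qed
  have jump_O: "jump y \<in> Orb" if yOrb: "y \<in> Orb" for y
  proof -
    obtain z and n :: int where "z \<in> X" "y = z + of_int n * \<tau>"
      using yOrb unfolding Orb_def translates_def by blast
    then obtain i where y: "i < Q" "y = (jump ^^ i) x + of_int n * \<tau>"
      by (auto simp: X_def)
    have "(jump ^^ Suc i) x \<in> Orb"
    proof (cases "Suc i < Q")
      case True
      then show ?thesis unfolding Orb_def
        by (intro subsetD[OF subset_translates]) (auto simp: X_def simp del: funpow.simps)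
    next
      case False
      then have "Suc i = Q" using y by simp
      moreover have "x \<in> Orb" unfolding Orb_def
        by (rule subsetD[OF subset_translates]) (use Q in \<open>force simp: X_def\<close>)
      ultimately show ?thesis
        using Q translates_shift[of x m] by (simp add: Orb_def del: funpow.simps)
    qed
    moreover have "jump y = (jump ^^ Suc i) x + of_int n * \<tau>"
      unfolding y(2) jump_shift by simp
    ultimately show ?thesis
      using translates_shift[of "(jump ^^ Suc i) x" n \<tau> X] by (simp only: Orb_def)
  qed
  have strict: "jump y < jump z" if "y \<in> Orb" "z \<in> Orb" "y < z" for y z
  proof -
    have "jump y \<noteq> jump z"
    proof
      assume "jump y = jump z"
      then have "(jump ^^ Suc (Q - 1)) y = (jump ^^ Suc (Q - 1)) z"
        unfolding funpow_Suc_right comp_apply by simp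
      then have "(jump ^^ Q) y = (jump ^^ Q) z" using Q(1) by simp
      then show False using return that by simp
    qed
    then show ?thesis using mono_jump[of y z] that by simp
  qed
  have onto: "\<exists>z\<in>Orb. jump z = y" if "y \<in> Orb" for y
  proof
    have "(jump ^^ i) z \<in> Orb" if "z \<in> Orb" for i z using that by (induction i) (auto intro: jump_O)
    then show "(jump ^^ (Q - 1)) (y + of_int (- m) * \<tau>) \<in> Orb"
      using that translates_shift[of y "- m"] by (simp add: Orb_def)
    have "jump ((jump ^^ (Q - 1)) (y + of_int (- m) * \<tau>)) = (jump ^^ Q) (y + of_int (- m) * \<tau>)"
      using funpow.simps(2)[of "Q - 1" jump] Q(1) by (simp del: funpow.simps)
    also have "\<dots> = y"
      using return[of "y + of_int (- m) * \<tau>"] that translates_shift[of y "- m"]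
      by (simp add: Orb_def)
    finally show "jump ((jump ^^ (Q - 1)) (y + of_int (- m) * \<tau>)) = y" .
  qed
  obtain q :: nat and y where y: "0 < q" "strict_mono y" "range y = Orb" "\<And>s. y (s + int q) = y s + \<tau>"
    by (rule periodic_enumeration[OF Orb]) (rule that)
  have "\<exists>r. jump (y s) = y r" for s using jump_O y(3) by (metis rangeE rangeI)
  then obtain f where f: "\<And>s. jump (y s) = y (f s)" by metis
  have "strict_mono f"
    unfolding strict_mono_def
    using strict f y(2,3) by (metis rangeI strict_mono_less)
  moreover have "surj f"
  proof (rule surjI)
    fix s
    have "\<exists>r. jump (y r) = y s" using onto[of "y s"] y(3) by auto
    then have "jump (y (SOME r. jump (y r) = y s)) = y s" by (rule someI_ex)
    then show "f (SOME r. jump (y r) = y s) = s"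
      using f strict_mono_eq[OF y(2)] by metis
  qed
  ultimately have "f s = s + f 0" for s by (rule strict_mono_surj_int_is_shift)
  then show thesis using that[OF y(1,2,4), of "f 0"] f by metis
qed

end

context lifted_chords
begin

text \<open>Along the orbit, \<open>jump (y s)\<close> is the end of a chord starting at a point \<open>w s\<close>. The starts
  \<open>w s\<close> interleave with the orbit, which makes the chords \<open>(w s, y (s + p))\<close> a star-like pattern of
  \<open>q\<close> chords modulo the period, and \<open>k * p < q\<close> because \<open>k\<close> jumps stay within a period. If \<open>q\<close> exceeds
  \<open>k * p\<close> by exactly one, the pattern is a star. Otherwise one of the \<open>q\<close> chords can be dropped: by the
  counting bound the remaining \<open>q - 1 > k * p\<close> chords cannot be hit by \<open>k\<close> cuts.\<close>

lemma star_or_smaller_unhittable: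
  assumes hard: "unhittable \<tau> L k E" and k: "2 \<le> k"
  obtains (star) p :: nat and h :: "int \<Rightarrow> real"
    where "0 < p" "strict_mono h" "\<And>i. h (i + 2 * (int k * int p + 1)) = h i + \<tau>"
      "\<And>s. (h (2 * s), h (2 * s + 2 * int p - 1)) \<in> E"
  | (smaller) E' where "E' \<subset> E" "lifted_chords \<tau> L E'" "unhittable \<tau> L k E'"
proof -
  have "E \<noteq> {}"
  proof
    assume "E = {}"
    then have "k < card ({} :: real set)" using hard unfolding unhittable_def by blast
    then show False by simp
  qed
  then interpret nonempty_lifted_chords \<tau> L E by unfold_locales
  obtain q :: nat and y :: "int \<Rightarrow> real" and p' :: int where y: "0 < q" "strict_mono y"
    "\<And>s. y (s + int q) = y s + \<tau>" and jump_y: "\<And>s. jump (y s) = y (s + p')"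
    by (rule ex_jump_orbit) (rule that)
  have y_less: "y s < y r \<longleftrightarrow> s < r" for s r using strict_mono_less[OF y(2)] .
  have y_eq: "y s = y r \<longleftrightarrow> s = r" for s r using strict_mono_eq[OF y(2)] .
  note y_shift = quasi_periodic_shift[of y q, OF y(3), symmetric]
  have "0 < p'" using less_jump[of "y 0"] y_less[of 0 p'] by (simp add: jump_y)
  define p where "p = nat p'"
  have p: "0 < p" "\<And>s. jump (y s) = y (s + int p)" using \<open>0 < p'\<close> jump_y by (simp_all add: p_def)
  have jumps_y: "(jump ^^ i) (y s) = y (s + int i * int p)" for i s
    by (induction i) (simp_all add: p algebra_simps)
  have kp: "int k * int p < int q"
    using jumps_less_period[OF hard, of "y 0"] y(3)[of 0] y_less[of "int k * int p" "int q"]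
    by (simp add: jumps_y)
  define w where "w s = from_pt (y s)" for s
  have w: "(w s, y (s + int p)) \<in> E" for s using first_chord_pair[of "y s"] by (simp add: w_def p)
  have w_shift: "w s + of_int n * \<tau> = w (s + n * int q)" for s n
    using from_pt_shift[of "y s" n] by (simp add: w_def y_shift)
  \<comment> \<open>If \<open>w s\<close> were the end \<open>y r\<close> of some chord of the pattern, flipping that chord would
    give the chord starting at \<open>w s\<close>. Two jumps would then reach a full period, which \<open>2 \<le> k\<close> excludes.\<close>
  have w_ne: "w s \<noteq> y r" for s r
  proof
    assume eq: "w s = y r"
    have "(y r, y (s + int p)) \<in> E" using w[of s] eq by simp
    moreover have "(y r, w (r - int p) + \<tau>) \<in> E" using w[of "r - int p"] flip_iff by simp
    ultimately have "y (s + int p) = w (r - int p) + \<tau>" by (rule chord_unique)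
    moreover have "y (r - int p) \<le> w (r - int p)" using first_chord(2) by (simp add: w_def)
    ultimately have "y (r - int p + int q) \<le> y (s + int p)" using y(3) by simp
    then have "r - int p + int q \<le> s + int p" using y_less by (meson not_le)
    moreover have "y s \<le> y r" using first_chord(2)[of "y s"] eq by (simp add: w_def)
    then have "s \<le> r" using y_less by (meson not_le)
    moreover have "2 * int p \<le> int k * int p" using k by (intro mult_right_mono) auto
    ultimately show False using kp by linarith
  qed
  have w_between: "y s < w s" "w s < y (s + 1)" for s
  proof -
    have "y s \<le> w s" using first_chord(2) by (simp add: w_def)
    then show "y s < w s" using w_ne[of s s] by simp
    show "w s < y (s + 1)"
    proof (rule ccontr)
      assume "\<not> ?thesis"
      then have "jump (y (s + 1)) \<le> y (s + int p)"
        using first_chord(3)[OF w[of s]] by simp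
      then show False using y_less[of "s + int p" "s + 1 + int p"] by (simp add: p)
    qed
  qed
  show thesis
  proof (cases "q = k * p + 1")
    case True
    \<comment> \<open>The half-crossings of the star in increasing order: \<open>w s\<close> has index \<open>2 * s\<close> and \<open>y s\<close> has index \<open>2 * s - 1\<close>.\<close>
    define h where "h i = (if even i then w (i div 2) else y (i div 2 + 1))" for i
    have "h i < h (i + 1)" for i
    proof (cases "even i")
      case True
      then show ?thesis using w_between(2)[of "i div 2"] by (simp add: h_def)
    next
      case False
      then have "(i + 1) div 2 = i div 2 + 1" by presburger
      then show ?thesis using w_between(1)[of "i div 2 + 1"] False by (simp add: h_def)
    qed
    then have "h i < h (i + 1 + int d)" for i d
    proof (induction d)
      case (Suc d)
      then show ?case using Suc.prems[of "i + 1 + int d"] by (auto simp: algebra_simps intro: less_trans)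
    qed simp
    then have "h i < h j" if "i < j" for i j
      using that by (metis zless_iff_Suc_zadd add.assoc of_nat_Suc add.commute)
    then have "strict_mono h" by (simp add: strict_mono_def)
    moreover have "h (i + 2 * (int k * int p + 1)) = h i + \<tau>" for i
    proof -
      have q: "int k * int p + 1 = int q" using True by simp
      have "(i + 2 * int q) div 2 = i div 2 + int q" by simp
      then show ?thesis unfolding q
        using w_shift[of "i div 2" 1] y_shift[of "i div 2 + 1" 1] by (simp add: h_def algebra_simps)
    qed
    moreover have "(h (2 * s), h (2 * s + 2 * int p - 1)) \<in> E" for s
    proof -
      have "odd (2 * s + 2 * int p - 1)" "(2 * s + 2 * int p - 1) div 2 + 1 = s + int p" by presburger+
      then show ?thesis using w[of s] by (simp add: h_def)
    qed
    ultimately show thesis using star p by blast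
  next
    case False
    then have q: "k * p < q - 1" using kp by (simp flip: of_nat_mult)
    \<comment> \<open>Both lifts of one crossing have to go, hence the deletion by end points.\<close>
    define B where "B = translates \<tau> {w 0, y (int p)}"
    define E' where "E' = {(u, v) \<in> E. u \<notin> B \<and> v \<notin> B}"
    have B: "x \<in> B \<longleftrightarrow> (\<exists>n. x = w (n * int q) \<or> x = y (int p + n * int q))" for x
    proof -
      have "x \<in> B \<longleftrightarrow> (\<exists>n. x = w 0 + of_int n * \<tau> \<or> x = y (int p) + of_int n * \<tau>)"
        by (auto simp: B_def translates_def)
      then show ?thesis by (simp add: w_shift y_shift)
    qed
    have "(w 0, y (int p)) \<notin> E'" using B[of "w 0"] by (auto simp: E'_def intro: exI[of _ 0])
    then have "E' \<noteq> E" using w[of 0] by auto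
    moreover have "E' \<subseteq> E" by (auto simp: E'_def)
    moreover have "lifted_chords \<tau> L E'"
    proof
      have "x + \<tau> \<in> B \<longleftrightarrow> x \<in> B" for x using translates_shift[of x 1] by (simp add: B_def)
      then show "(v, u + \<tau>) \<in> E' \<longleftrightarrow> (u, v) \<in> E'" for u v by (auto simp: E'_def flip_iff)
    qed (use L chord_bounds chord_unique start_in_L in \<open>auto simp: E'_def\<close>)
    moreover have "unhittable \<tau> L k E'"
      unfolding unhittable_def
    proof (intro allI impI, elim conjE)
      fix Q assume Q: "finite Q" "Q \<inter> L = {}" "\<forall>(u, v)\<in>E'. hits \<tau> Q u v"
      have w_eq: "w s = w r \<longleftrightarrow> s = r" for s r
        using w_between[of s] w_between[of r] y_less[of r "s + 1"] y_less[of s "r + 1"]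
        by (metis less_trans zless_add1_eq order.asym)
      have "translates \<tau> Q \<inter> {y s..<y (s + int p)} \<noteq> {}" if s: "s \<in> {1..<int q}" for s
      proof -
        have "\<not> int q dvd s" using s by (auto dest: zdvd_imp_le)
        then have ndvd: "s \<noteq> n * int q" for n by auto
        then have "w s \<notin> B" "y (s + int p) \<notin> B"
          using w_ne not_sym[OF w_ne] unfolding B w_eq y_eq by (auto simp: algebra_simps)
        then have "hits \<tau> Q (w s) (y (s + int p))" using w[of s] Q(3) by (auto simp: E'_def)
        then obtain x where x: "x \<in> translates \<tau> Q" "w s \<le> x" "x \<le> y (s + int p)"
          by (auto simp: hits_def)
        have "x \<notin> L"
        proof -
          obtain z and n :: int where "z \<in> Q" "x = z + of_int n * \<tau>"
            using x(1) by (auto simp: translates_def)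
          then show ?thesis using Q(2) periodic_discrete_shift[OF L] by auto
        qed
        moreover have "y (s + int p) \<in> L" using end_in_L w by blast
        ultimately have "x < y (s + int p)" using x by (auto simp: less_le)
        then show ?thesis using x w_between(1)[of s] by force
      qed
      then have "card {1..<int q} \<le> p * card Q"
        by (intro card_hit_intervals_le[OF period_pos y(1,2,3) Q(1)]) auto
      moreover have "card {1..<int q} = q - 1" by (simp add: nat_diff_distrib)
      ultimately have "q - 1 \<le> p * card Q" by simp
      then have "k * p < p * card Q" using q by linarith
      then have "p * k < p * card Q" by (simp only: mult.commute)
      then show "k < card Q" using p(1) by simp
    qed
    ultimately show thesis using smaller by blast
  qed
qed

end

text \<open>A chord can be dropped only finitely often, as there are finitely many chords modulo the period.\<close>

lemma star_in_unhittable: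
  assumes "lifted_chords \<tau> L E" "unhittable \<tau> L k E" "2 \<le> k"
  shows "\<exists>(p::nat) h :: int \<Rightarrow> real. 0 < p \<and> strict_mono h \<and>
     (\<forall>i. h (i + 2 * (int k * int p + 1)) = h i + \<tau>) \<and>
     (\<forall>s. (h (2 * s), h (2 * s + 2 * int p - 1)) \<in> E)"
  using assms
proof (induction "card {e \<in> E. 0 \<le> fst e \<and> fst e \<le> \<tau>}" arbitrary: E rule: less_induct)
  case less
  interpret lifted_chords \<tau> L E by (rule less.prems)
  show ?case
  proof (cases rule: star_or_smaller_unhittable[OF less.prems(2,3)])
    case (1 p h)
    then show ?thesis by blast
  next
    case (2 E')
    interpret E': lifted_chords \<tau> L E' by (rule 2)
    obtain e where e: "e \<in> E" "e \<notin> E'" using 2 by auto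
    obtain n :: int where n: "0 \<le> fst e + of_int n * \<tau>" "fst e + of_int n * \<tau> < 0 + \<tau>"
      using window_representative[OF period_pos] by blast
    define e' where "e' = (fst e + of_int n * \<tau>, snd e + of_int n * \<tau>)"
    have "e' \<in> E" "e' \<notin> E'" using e chord_shift E'.chord_shift by (auto simp: e'_def)
    moreover have "0 \<le> fst e'" "fst e' \<le> \<tau>" using n by (auto simp: e'_def)
    ultimately have "{e \<in> E'. 0 \<le> fst e \<and> fst e \<le> \<tau>} \<subset> {e \<in> E. 0 \<le> fst e \<and> fst e \<le> \<tau>}"
      using 2(1) by blast
    then have "card {e \<in> E'. 0 \<le> fst e \<and> fst e \<le> \<tau>} < card {e \<in> E. 0 \<le> fst e \<and> fst e \<le> \<tau>}"
      by (rule psubset_card_mono[OF finite_chords_from])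
    from less.hyps[OF this 2(2,3) less.prems(3)] show ?thesis using 2(1) by blast
  qed
qed

section \<open>Angular coordinates on an oriented circle\<close>

definition at_angle :: "'p ocircle \<Rightarrow> real \<Rightarrow> 'p" where
  "at_angle C s = positive_param C (cis s)"

definition angles :: "'p ocircle \<Rightarrow> 'p set \<Rightarrow> real set" where
  "angles C H = {s. at_angle C s \<in> H}"

lemma cis_eq_iff: "cis s = cis s' \<longleftrightarrow> (\<exists>n::int. s' = s + of_int n * (2 * pi))"
proof -
  have "cis s = cis s' \<longleftrightarrow> sin s' = sin s \<and> cos s' = cos s"
    by (auto simp: complex_eq_iff)
  also have "\<dots> \<longleftrightarrow> (\<exists>n::int. s' = s + of_int n * (2 * pi))"
    unfolding sin_cos_eq_iff by (simp add: mult.commute)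
  finally show ?thesis .
qed

context
  fixes C :: "'p ocircle"
  assumes C: "oriented_circle C"
begin

lemma param_homeo: "homeomorphic_map (top_of_set (sphere 0 1)) (space_of C) (positive_param C)"
  using C by (simp add: oriented_circle_def)

lemma at_angle_in_points: "at_angle C s \<in> points C"
  using homeomorphic_imp_surjective_map[OF param_homeo] by (auto simp: at_angle_def)

lemma at_angle_eq_iff: "at_angle C s = at_angle C s' \<longleftrightarrow> (\<exists>n::int. s' = s + of_int n * (2 * pi))"
proof -
  have "at_angle C s = at_angle C s' \<longleftrightarrow> cis s = cis s'"
    using homeomorphic_imp_injective_map[OF param_homeo] by (auto simp: at_angle_def inj_on_def)
  then show ?thesis by (simp add: cis_eq_iff)
qed

lemma at_angle_shift: "at_angle C (s + of_int n * (2 * pi)) = at_angle C s"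
  by (metis at_angle_eq_iff)

lemma at_angle_inj_window:
  assumes "at_angle C s = at_angle C s'" "a \<le> s" "s < a + 2 * pi" "a \<le> s'" "s' < a + 2 * pi"
  shows "s = s'"
proof -
  obtain n :: int where n: "s' = s + of_int n * (2 * pi)" using assms(1) at_angle_eq_iff by blast
  then have "of_int n * (2 * pi) < 1 * (2 * pi)" "- 1 * (2 * pi) < of_int n * (2 * pi)"
    using assms by linarith+
  then have "n < 1" "- 1 < n" using pi_gt_zero by (simp_all only: mult_less_cancel_right) auto
  then show ?thesis using n by simp
qed

lemma points_at_angle:
  assumes "x \<in> points C"
  obtains s where "a \<le> s" "s < a + 2 * pi" "at_angle C s = x"
proof -
  have "positive_param C ` sphere 0 1 = points C"
    using homeomorphic_imp_surjective_map[OF param_homeo] by simp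
  then have "x \<in> positive_param C ` sphere 0 1" using assms by simp
  then obtain z where z: "z \<in> sphere 0 1" "positive_param C z = x" by blast
  have "cis (Arg z) = z" using z rcis_cmod_Arg[of z] by (simp add: rcis_def)
  then have *: "at_angle C (Arg z) = x" using z by (simp add: at_angle_def)
  obtain n :: int where "a \<le> Arg z + of_int n * (2 * pi)" "Arg z + of_int n * (2 * pi) < a + 2 * pi"
    using window_representative[of "2 * pi" a "Arg z"] by auto
  then show thesis by (rule that) (simp only: at_angle_shift *)
qed

lemma ex_angle: "x \<in> points C \<Longrightarrow> \<exists>s. at_angle C s = x"
  by (rule points_at_angle[of x 0]) (auto intro: exI)

lemma at_angle_full_turn: "at_angle C ` {0..2 * pi} = points C"
proof
  show "points C \<subseteq> at_angle C ` {0..2 * pi}"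
  proof
    fix x assume "x \<in> points C"
    then obtain s where "0 \<le> s" "s < 0 + 2 * pi" "at_angle C s = x"
      by (rule points_at_angle[of x 0])
    then show "x \<in> at_angle C ` {0..2 * pi}" by force
  qed
qed (use at_angle_in_points in auto)

lemma continuous_at_angle: "continuous_map euclideanreal (space_of C) (at_angle C)"
proof -
  have "continuous_map euclideanreal (top_of_set (sphere 0 1)) cis"
    by (auto simp: continuous_map_in_subtopology intro: continuous_intros)
  then have "continuous_map euclideanreal (space_of C) (positive_param C \<circ> cis)"
    using homeomorphic_imp_continuous_map[OF param_homeo] by (rule continuous_map_compose)
  then show ?thesis by (simp add: at_angle_def[abs_def] comp_def)
qed

lemma Hausdorff_circle: "Hausdorff_space (space_of C)"
proof -
  have "Hausdorff_space (top_of_set (sphere (0::complex) 1))"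
    by (simp add: Hausdorff_space_subtopology)
  then show ?thesis
    using homeomorphic_Hausdorff_space homeomorphic_map_imp_homeomorphic_space param_homeo by blast
qed

lemma closedin_at_angle_Icc: "closedin (space_of C) (at_angle C ` {a..b})"
  by (rule compactin_imp_closedin[OF Hausdorff_circle image_compactin[OF _ continuous_at_angle]]) simp

lemma connectedin_at_angle:
  assumes "connected S"
  shows "connectedin (space_of C) (at_angle C ` S)"
  by (rule connectedin_continuous_map_image[OF continuous_at_angle]) (use assms in simp)

text \<open>An open arc is open because its complement is the image of a compact interval.\<close>

lemma openin_at_angle_Ioo:
  assumes "\<beta> \<le> \<alpha> + 2 * pi"
  shows "openin (space_of C) (at_angle C ` {\<alpha><..<\<beta>})"
proof (cases "\<alpha> < \<beta>")
  case True
  have "at_angle C ` {\<alpha><..<\<beta>} = points C - at_angle C ` {\<beta>..\<alpha> + 2 * pi}"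
  proof
    show "at_angle C ` {\<alpha><..<\<beta>} \<subseteq> points C - at_angle C ` {\<beta>..\<alpha> + 2 * pi}"
    proof clarify
      fix s assume s: "s \<in> {\<alpha><..<\<beta>}"
      have "at_angle C s \<noteq> at_angle C s'" if "s' \<in> {\<beta>..\<alpha> + 2 * pi}" for s'
      proof
        assume "at_angle C s = at_angle C s'"
        from at_angle_inj_window[OF this, of s] s that assms show False by auto
      qed
      then have "at_angle C s \<notin> at_angle C ` {\<beta>..\<alpha> + 2 * pi}" by blast
      then show "at_angle C s \<in> points C - at_angle C ` {\<beta>..\<alpha> + 2 * pi}"
        using at_angle_in_points by blast
    qed
    show "points C - at_angle C ` {\<beta>..\<alpha> + 2 * pi} \<subseteq> at_angle C ` {\<alpha><..<\<beta>}"
    proof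
      fix x assume x: "x \<in> points C - at_angle C ` {\<beta>..\<alpha> + 2 * pi}"
      obtain s where s: "\<alpha> \<le> s" "s < \<alpha> + 2 * pi" "at_angle C s = x"
        using x by (auto intro: points_at_angle[of x \<alpha>])
      have "at_angle C (\<alpha> + 2 * pi) = at_angle C \<alpha>" using at_angle_shift[of \<alpha> 1] by simp
      moreover have "at_angle C (\<alpha> + 2 * pi) \<in> at_angle C ` {\<beta>..\<alpha> + 2 * pi}" using assms by simp
      ultimately have "s \<noteq> \<alpha>" using s x by auto
      moreover have "s < \<beta>" using s x by force
      ultimately show "x \<in> at_angle C ` {\<alpha><..<\<beta>}" using s by auto
    qed
  qed
  then show ?thesis using closedin_at_angle_Icc by (simp add: openin_diff)
qed simp

lemma open_arc_at_angle:
  "open_arc C r \<longleftrightarrow> (\<exists>\<alpha> \<beta>. \<alpha> < \<beta> \<and> \<beta> \<le> \<alpha> + 2 * pi \<and> r = at_angle C ` {\<alpha><..<\<beta>})"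
  by (simp add: open_arc_def at_angle_def)

lemma angles_image: "angles C (at_angle C ` Q) = translates (2 * pi) Q"
proof -
  have "at_angle C s \<in> at_angle C ` Q \<longleftrightarrow> (\<exists>z\<in>Q. at_angle C z = at_angle C s)" for s
    by (metis imageE imageI)
  then show ?thesis unfolding angles_def translates_def at_angle_eq_iff by blast
qed

lemma ex_angle_representatives:
  assumes "H \<subseteq> points C"
  obtains f where "at_angle C ` (f ` H) = H"
proof -
  have "\<forall>x\<in>H. \<exists>s. at_angle C s = x" using assms ex_angle by (meson subsetD)
  then obtain f where "\<forall>x\<in>H. at_angle C (f x) = x" by metis
  then show thesis by (intro that[of f]) (simp add: image_image)
qed

lemma periodic_discrete_angles:
  assumes "H \<subseteq> points C" "finite H"
  shows "periodic_discrete (2 * pi) (angles C H)"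
proof -
  obtain f where "at_angle C ` (f ` H) = H" using ex_angle_representatives[OF assms(1)] .
  then have "angles C H = translates (2 * pi) (f ` H)" using angles_image[of "f ` H"] by simp
  then show ?thesis using periodic_discrete_translates[of "2 * pi" "f ` H"] assms by simp
qed

text \<open>The component of a point is the arc between the nearest cut angles on its two sides. This arc is
  connected, and it is both open and closed in the cut circle: adding its ends, which are cut points, makes it
  compact.\<close>

lemma component_of_cut_circle:
  assumes P: "finite P" "P \<subseteq> points C" "P \<noteq> {}"
    and r: "r \<in> connected_components_of (subtopology (space_of C) (points C - P))"
  obtains \<alpha> \<beta> where "\<alpha> < \<beta>" "\<beta> \<le> \<alpha> + 2 * pi" "at_angle C \<alpha> \<in> P" "at_angle C \<beta> \<in> P"
    "angles C P \<inter> {\<alpha><..<\<beta>} = {}" "r = at_angle C ` {\<alpha><..<\<beta>}"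
proof -
  let ?X = "subtopology (space_of C) (points C - P)"
  have pd: "periodic_discrete (2 * pi) (angles C P)"
    using periodic_discrete_angles[OF P(2,1)] .
  have ne: "angles C P \<noteq> {}"
  proof -
    obtain x where "x \<in> P" using P by auto
    then have "x \<in> points C" using P by auto
    then obtain s where "at_angle C s = x" using ex_angle by blast
    then have "s \<in> angles C P" using \<open>x \<in> P\<close> by (simp add: angles_def)
    then show ?thesis by blast
  qed
  obtain x where x: "x \<in> points C" "x \<notin> P" "r = connected_component_of_set ?X x"
    using r by (auto simp: connected_components_of_def)
  obtain s where s: "at_angle C s = x" using ex_angle[OF x(1)] by blast
  have sP: "s \<notin> angles C P" using x s by (simp add: angles_def)
  obtain \<alpha> where \<alpha>: "\<alpha> \<in> angles C P" "\<alpha> \<le> s" "angles C P \<inter> {\<alpha><..s} = {}"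
    using ex_nearest_below[OF pd ne] .
  have "\<alpha> < s" using \<alpha> sP by (auto simp: less_le)
  have \<alpha>': "\<alpha> + 2 * pi \<in> angles C P" using pd \<alpha>(1) by (simp add: periodic_discrete_def)
  have "s < \<alpha> + 2 * pi"
  proof (rule ccontr)
    assume "\<not> s < \<alpha> + 2 * pi"
    then have "\<alpha> + 2 * pi \<in> {\<alpha><..s}" using pi_gt_zero by auto
    then show False using \<alpha> \<alpha>' by blast
  qed
  define B where "B = angles C P \<inter> {s..\<alpha> + 2 * pi}"
  have B: "finite B" "B \<noteq> {}"
    using pd \<alpha>' \<open>s < \<alpha> + 2 * pi\<close> by (auto simp: B_def periodic_discrete_def)
  define \<beta> where "\<beta> = Min B"
  have "\<beta> \<in> B" using B by (simp add: \<beta>_def)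
  then have \<beta>: "\<beta> \<in> angles C P" "s < \<beta>" "\<beta> \<le> \<alpha> + 2 * pi"
    using sP by (auto simp: B_def less_le)
  have gap: "angles C P \<inter> {\<alpha><..<\<beta>} = {}"
  proof (rule ccontr)
    assume "angles C P \<inter> {\<alpha><..<\<beta>} \<noteq> {}"
    then obtain z where z: "z \<in> angles C P" "\<alpha> < z" "z < \<beta>" by auto
    show False
    proof (cases "z \<le> s")
      case True
      then show False using z \<alpha> by auto
    next
      case False
      then have "z \<in> B" using z \<beta> by (auto simp: B_def)
      then show False using z B by (auto simp: \<beta>_def)
    qed
  qed
  define A where "A = at_angle C ` {\<alpha><..<\<beta>}"
  have AP: "A \<subseteq> points C - P"
    using gap at_angle_in_points by (auto simp: A_def angles_def)
  have A_eq: "A = at_angle C ` {\<alpha>..\<beta>} \<inter> (points C - P)"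
  proof -
    have "{\<alpha>..\<beta>} = insert \<alpha> (insert \<beta> {\<alpha><..<\<beta>})" using \<beta> \<open>\<alpha> < s\<close> by auto
    then show ?thesis using AP \<alpha>(1) \<beta>(1) by (auto simp: A_def angles_def)
  qed
  have "openin ?X A"
    using openin_at_angle_Ioo[OF \<beta>(3)] AP by (auto simp: openin_subtopology A_def)
  moreover have "closedin ?X A"
    unfolding closedin_subtopology A_eq using closedin_at_angle_Icc by blast
  moreover have "connectedin ?X r"
    unfolding x(3) by (rule connectedin_connected_component_of)
  moreover have "x \<in> A" using s \<beta> \<open>\<alpha> < s\<close> by (auto simp: A_def)
  moreover have "x \<in> r" using x by (simp add: connected_component_of_refl)
  ultimately have "r \<subseteq> A" using connectedin_clopen_cases[of ?X r A] by (auto simp: disjnt_def)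
  moreover have "A \<subseteq> r"
    unfolding x(3)
  proof (rule connected_component_of_maximal)
    show "connectedin ?X A"
      using connectedin_at_angle[of "{\<alpha><..<\<beta>}"] AP by (simp add: connectedin_subtopology A_def)
  qed (rule \<open>x \<in> A\<close>)
  ultimately have "r = A" by simp
  with that[of \<alpha> \<beta>] \<alpha> \<beta> \<open>\<alpha> < s\<close> gap show thesis by (simp add: A_def angles_def)
qed

end

section \<open>Embedded partitions\<close>

definition lifts :: "'p ocircle \<Rightarrow> 'p set set \<Rightarrow> (real \<times> real) set" where
  "lifts C X = {(u, v). u < v \<and> v < u + 2 * pi \<and> {at_angle C u, at_angle C v} \<in> X}"

lemma lifted_chords_diagram:
  assumes "chord_diagram D"
  shows "lifted_chords (2 * pi) (angles (circle D) (half_crossings D)) (lifts (circle D) (crossings D))"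
proof -
  have C: "oriented_circle (circle D)" and H: "half_crossings D \<subseteq> points (circle D)" "finite (half_crossings D)"
    and part: "partition_on (half_crossings D) (crossings D)" and card: "\<And>x. x \<in> crossings D \<Longrightarrow> card x = 2"
    using assms by (auto simp: chord_diagram_def)
  have period: "at_angle (circle D) (s + 2 * pi) = at_angle (circle D) s" for s
    using at_angle_shift[OF C, of s 1] by simp
  show ?thesis
  proof
    show "periodic_discrete (2 * pi) (angles (circle D) (half_crossings D))"
      by (rule periodic_discrete_angles[OF C H])
    show "u < v \<and> v < u + 2 * pi" if "(u, v) \<in> lifts (circle D) (crossings D)" for u v
      using that by (simp add: lifts_def)
    show "(v, u + 2 * pi) \<in> lifts (circle D) (crossings D) \<longleftrightarrow> (u, v) \<in> lifts (circle D) (crossings D)" for u v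
      by (auto simp: lifts_def period insert_commute)
    show "v = v'" if "(u, v) \<in> lifts (circle D) (crossings D)" "(u, v') \<in> lifts (circle D) (crossings D)" for u v v'
    proof -
      let ?x = "{at_angle (circle D) u, at_angle (circle D) v}" and ?x' = "{at_angle (circle D) u, at_angle (circle D) v'}"
      have "?x \<in> crossings D" "?x' \<in> crossings D" using that by (auto simp: lifts_def)
      moreover have "?x \<inter> ?x' \<noteq> {}" by blast
      ultimately have "?x = ?x'" using disjointD[OF partition_onD2[OF part]] by blast
      moreover have "card ?x = 2" using \<open>?x \<in> crossings D\<close> by (rule card)
      ultimately have "at_angle (circle D) v = at_angle (circle D) v'"
        by (metis doubleton_eq_iff)
      then show ?thesis
        using that by (intro at_angle_inj_window[OF C, of v v' u]) (auto simp: lifts_def)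
    qed
    show "u \<in> angles (circle D) (half_crossings D)" if "(u, v) \<in> lifts (circle D) (crossings D)" for u v
      using that part C by (auto simp: lifts_def partition_on_def angles_def)
  qed
qed

lemma embedded_partition_if_hits:
  assumes D: "chord_diagram D" and Q: "finite Q" "Q \<noteq> {}" "Q \<inter> angles (circle D) (half_crossings D) = {}"
    and hits: "\<And>u v. (u, v) \<in> lifts (circle D) (crossings D) \<Longrightarrow> hits (2 * pi) Q u v"
  shows "embedded_partition D (at_angle (circle D) ` Q)"
proof -
  let ?C = "circle D"
  let ?P = "at_angle ?C ` Q"
  have C: "oriented_circle ?C" using D by (simp add: chord_diagram_def)
  have card: "\<And>x. x \<in> crossings D \<Longrightarrow> card x = 2" using D by (auto simp: chord_diagram_def)
  have reg: "?P \<subseteq> regular_points D"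
    using Q(3) at_angle_in_points[OF C] by (auto simp: regular_points_def angles_def)
  have "properly_embedded D r"
    if r: "r \<in> connected_components_of (subtopology (space_of ?C) (points ?C - ?P))" for r
  proof -
    have P: "finite ?P" "?P \<subseteq> points ?C" "?P \<noteq> {}" using Q at_angle_in_points[OF C] by auto
    obtain \<alpha> \<beta> where ab: "\<alpha> < \<beta>" "\<beta> \<le> \<alpha> + 2 * pi" "at_angle ?C \<alpha> \<in> ?P" "at_angle ?C \<beta> \<in> ?P"
      "angles ?C ?P \<inter> {\<alpha><..<\<beta>} = {}" "r = at_angle ?C ` {\<alpha><..<\<beta>}"
      by (rule component_of_cut_circle[OF C P r]) (rule that)
    have "open_arc ?C r" using ab by (auto simp: open_arc_at_angle[OF C])
    moreover have "space_of ?C frontier_of r \<subseteq> ?P"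
    proof -
      have "space_of ?C closure_of r \<subseteq> at_angle ?C ` {\<alpha>..\<beta>}"
        unfolding ab(6) by (rule closure_of_minimal[OF _ closedin_at_angle_Icc[OF C]]) auto
      moreover have "space_of ?C interior_of r = r"
        using openin_at_angle_Ioo[OF C ab(2)] by (simp add: ab(6) interior_of_openin)
      moreover have "{\<alpha>..\<beta>} = insert \<alpha> (insert \<beta> {\<alpha><..<\<beta>})" using ab(1) by auto
      ultimately show ?thesis using ab(3,4,6) by (auto simp: frontier_of_def)
    qed
    moreover have "\<not> x \<subseteq> r" if x: "x \<in> crossings D" for x
    proof
      assume "x \<subseteq> r"
      obtain b c where "x = {b, c}" "b \<noteq> c" using card[OF x] by (auto simp: card_2_iff)
      then obtain u v where uv: "u \<in> {\<alpha><..<\<beta>}" "v \<in> {\<alpha><..<\<beta>}" "x = {at_angle ?C u, at_angle ?C v}" "u \<noteq> v"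
        using \<open>x \<subseteq> r\<close> unfolding ab(6) by blast
      have "\<exists>u v. u \<in> {\<alpha><..<\<beta>} \<and> v \<in> {\<alpha><..<\<beta>} \<and> x = {at_angle ?C u, at_angle ?C v} \<and> u < v"
      proof (cases "u < v")
        case False
        then show ?thesis using uv by (intro exI[of _ v] exI[of _ u]) auto
      qed (use uv in blast)
      then obtain u v where uv: "u \<in> {\<alpha><..<\<beta>}" "v \<in> {\<alpha><..<\<beta>}" "x = {at_angle ?C u, at_angle ?C v}" "u < v"
        by blast
      then have "(u, v) \<in> lifts ?C (crossings D)" using ab(2) x by (auto simp: lifts_def)
      then have "translates (2 * pi) Q \<inter> {u..v} \<noteq> {}" using hits by (simp add: hits_def)
      then show False using uv ab(5) by (auto simp: angles_image[OF C])
    qed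
    ultimately show ?thesis using reg by (auto simp: properly_embedded_def regular_arc_def)
  qed
  then show ?thesis using Q reg by (simp add: embedded_partition_def)
qed

text \<open>In this form, the defining property of an embedded partition can be moved along any
  homeomorphism, whatever it does to the angles.\<close>

lemma connected_contains_no_crossing:
  assumes "embedded_partition D P" "connectedin (space_of (circle D)) K" "K \<inter> P = {}" "x \<in> crossings D" "x \<noteq> {}"
  shows "\<not> x \<subseteq> K"
proof
  assume "x \<subseteq> K"
  let ?X = "subtopology (space_of (circle D)) (points (circle D) - P)"
  obtain b where "b \<in> x" "b \<in> K" using assms \<open>x \<subseteq> K\<close> by auto
  have "connectedin ?X K"
    using assms connectedin_subset_topspace[OF assms(2)] by (auto simp: connectedin_subtopology)
  then have "K \<subseteq> connected_component_of_set ?X b"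
    using \<open>b \<in> K\<close> by (rule connected_component_of_maximal)
  moreover have "b \<in> topspace ?X"
    using \<open>connectedin ?X K\<close> \<open>b \<in> K\<close> connectedin_subset_topspace by blast
  then have "connected_component_of_set ?X b \<in> connected_components_of ?X"
    by (auto simp: connected_components_of_def)
  then have "properly_embedded D (connected_component_of_set ?X b)"
    using assms(1) by (simp add: embedded_partition_def)
  moreover have "x \<subseteq> connected_component_of_set ?X b" using calculation(1) \<open>x \<subseteq> K\<close> by (rule subset_trans[rotated])
  ultimately show False using assms(4) unfolding properly_embedded_def by blast
qed

text \<open>This makes the minimum in the definition of the arc number meaningful. One cut is placed
  just below every half-crossing; the additional cut near \<open>0\<close> covers the diagram without crossings, where the
  set of cut points would be empty.\<close>

lemma ex_embedded_partition:
  assumes D: "chord_diagram D"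
  shows "\<exists>P. embedded_partition D P"
proof -
  let ?C = "circle D"
  let ?L = "angles ?C (half_crossings D)"
  interpret lifted_chords "2 * pi" ?L "lifts ?C (crossings D)"
    by (rule lifted_chords_diagram[OF D])
  have C: "oriented_circle ?C" using D by (simp add: chord_diagram_def)
  have "\<exists>c<y. ?L \<inter> {c..<y} = {}" for y by (rule ex_gap_below[OF L])
  then obtain c where c: "\<And>y. c y < y" "\<And>y s. s \<in> ?L \<Longrightarrow> c y \<le> s \<Longrightarrow> y \<le> s"
    by (metis atLeastLessThan_iff disjoint_iff not_le)
  define Q where "Q = insert (c 0) (c ` (?L \<inter> {0..2 * pi}))"
  have "finite Q" using L by (auto simp: Q_def periodic_discrete_def)
  moreover have "Q \<inter> ?L = {}" using c by (auto simp: Q_def dest: leD)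
  moreover have "hits (2 * pi) Q u v" if uv: "(u, v) \<in> lifts ?C (crossings D)" for u v
  proof -
    obtain n :: int where n: "0 \<le> v + of_int n * (2 * pi)" "v + of_int n * (2 * pi) < 0 + 2 * pi"
      using window_representative[OF period_pos] by blast
    let ?u = "u + of_int n * (2 * pi)" and ?v = "v + of_int n * (2 * pi)"
    have *: "(?u, ?v) \<in> lifts ?C (crossings D)" using uv chord_shift by blast
    then have "?u \<in> ?L" "?v \<in> ?L" "?u < ?v" using start_in_L end_in_L chord_bounds by blast+
    then have "?u < c ?v" "c ?v < ?v" using c(1)[of ?v] c(2)[of ?u ?v] by (meson not_le)+
    moreover have "c ?v \<in> translates (2 * pi) Q"
      by (rule subsetD[OF subset_translates]) (use n \<open>?v \<in> ?L\<close> in \<open>auto simp: Q_def\<close>)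
    ultimately have "c ?v + of_int (- n) * (2 * pi) \<in> translates (2 * pi) Q \<inter> {u..v}"
      using translates_shift[of "c ?v" "- n" "2 * pi" Q] by auto
    then show ?thesis by (auto simp: hits_def)
  qed
  moreover have "Q \<noteq> {}" by (simp add: Q_def)
  ultimately show ?thesis using embedded_partition_if_hits[OF D] by blast
qed

section \<open>Homeomorphisms with prescribed angles\<close>

text \<open>The piecewise linear map \<open>e\<close> through the values \<open>h i\<close> at the integers is easy to write down; the map
  \<open>g\<close> is its inverse. It is continuous simply because it is increasing and onto.\<close>

lemma ex_increasing_interpolation:
  fixes h :: "int \<Rightarrow> real" and N :: nat
  assumes h: "strict_mono h" "\<And>i. h (i + int N) = h i + \<tau>" and N: "0 < N" and \<tau>: "0 < \<tau>"
  obtains g :: "real \<Rightarrow> real"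
  where "continuous_on UNIV g" "strict_mono g" "surj g"
    "\<And>s. g (s + \<tau>) = g s + real N" "\<And>i. g (h i) = of_int i"
proof -
  define e where "e v = h \<lfloor>v\<rfloor> + frac v * (h (\<lfloor>v\<rfloor> + 1) - h \<lfloor>v\<rfloor>)" for v :: real
  have step: "h i < h (i + 1)" for i using h(1) by (simp add: strict_mono_less)
  have e_bounds: "h \<lfloor>v\<rfloor> \<le> e v" "e v < h (\<lfloor>v\<rfloor> + 1)" for v
  proof -
    have "0 \<le> frac v * (h (\<lfloor>v\<rfloor> + 1) - h \<lfloor>v\<rfloor>)" using step[of "\<lfloor>v\<rfloor>"] by simp
    moreover have "frac v * (h (\<lfloor>v\<rfloor> + 1) - h \<lfloor>v\<rfloor>) < 1 * (h (\<lfloor>v\<rfloor> + 1) - h \<lfloor>v\<rfloor>)"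
      by (rule mult_strict_right_mono) (use step[of "\<lfloor>v\<rfloor>"] frac_lt_1 in auto)
    ultimately show "h \<lfloor>v\<rfloor> \<le> e v" "e v < h (\<lfloor>v\<rfloor> + 1)" by (simp_all add: e_def)
  qed
  have e_less: "e v < e w" if "v < w" for v w
  proof (cases "\<lfloor>v\<rfloor> = \<lfloor>w\<rfloor>")
    case True
    then have "frac v < frac w" using that by (simp add: frac_def)
    then show ?thesis using step[of "\<lfloor>w\<rfloor>"] True by (simp add: e_def)
  next
    case False
    then have "\<lfloor>v\<rfloor> + 1 \<le> \<lfloor>w\<rfloor>" using floor_mono[of v w] that by linarith
    then have "h (\<lfloor>v\<rfloor> + 1) \<le> h \<lfloor>w\<rfloor>" using h(1) by (simp add: strict_mono_less_eq)
    then show ?thesis using e_bounds(2)[of v] e_bounds(1)[of w] by linarith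
  qed
  then have e_mono: "strict_mono e" by (simp add: strict_mono_def)
  have e_period: "e (v + real N) = e v + \<tau>" for v
  proof -
    have "\<lfloor>v + real N\<rfloor> = \<lfloor>v\<rfloor> + int N" "frac (v + real N) = frac v"
      by (simp_all add: frac_def)
    then show ?thesis using h(2)[of "\<lfloor>v\<rfloor>"] h(2)[of "\<lfloor>v\<rfloor> + 1"] by (simp add: e_def algebra_simps)
  qed
  have e_shift: "e (v + of_int n * real N) = e v + of_int n * \<tau>" for v n
  proof (induction n rule: int_induct[where k = 0])
    case (step1 i)
    then show ?case using e_period[of "v + of_int i * real N"] by (simp add: algebra_simps)
  next
    case (step2 i)
    then show ?case using e_period[of "v + of_int (i - 1) * real N"] by (simp add: algebra_simps)
  qed simp
  have "surj e"
    unfolding surj_def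
  proof
    fix s
    obtain n :: int where n: "h 0 \<le> s + of_int n * \<tau>" "s + of_int n * \<tau> < h 0 + \<tau>"
      using window_representative[OF \<tau>] by blast
    define s' where "s' = s + of_int n * \<tau>"
    define A where "A = {i \<in> {0..int N}. h i \<le> s'}"
    have "A \<subseteq> {0..int N}" by (auto simp: A_def)
    then have A: "finite A" "A \<noteq> {}" using n finite_subset by (auto simp: A_def s'_def)
    define i where "i = Max A"
    have i: "0 \<le> i" "i \<le> int N" "h i \<le> s'" using Max_in[OF A] by (auto simp: A_def i_def)
    have "i \<noteq> int N" using i n h(2)[of 0] by (auto simp: s'_def)
    have "s' < h (i + 1)"
    proof (rule ccontr)
      assume "\<not> s' < h (i + 1)"
      then have "i + 1 \<in> A" using i \<open>i \<noteq> int N\<close> by (auto simp: A_def)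
      then show False using A Max_ge[of A "i + 1"] by (simp add: i_def)
    qed
    define t where "t = (s' - h i) / (h (i + 1) - h i)"
    have t: "0 \<le> t" "t < 1" using i \<open>s' < h (i + 1)\<close> step[of i] by (simp_all add: t_def)
    have "\<lfloor>of_int i + t\<rfloor> = i" using t by linarith
    then have "e (of_int i + t) = s'" using t step[of i] by (simp add: e_def frac_def t_def)
    then have "e (of_int i + t + of_int (- n) * real N) = s"
      unfolding e_shift by (simp add: s'_def)
    then show "\<exists>v. s = e v" by metis
  qed
  define g where "g = inv e"
  have eg: "e (g s) = s" for s using \<open>surj e\<close> by (simp add: g_def surj_f_inv_f)
  have ge: "g (e v) = v" for v
    using strict_mono_imp_inj_on[OF e_mono] by (simp add: g_def inv_f_f)
  have g_mono: "strict_mono g"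
    unfolding strict_mono_def
  proof (intro allI impI)
    fix x y :: real assume "x < y"
    then have "e (g x) < e (g y)" by (simp add: eg)
    then show "g x < g y" using strict_mono_less[OF e_mono] by blast
  qed
  have "surj g" using ge by (metis surjI)
  show thesis
  proof
    show "continuous_on UNIV g"
      by (rule continuous_onI_mono)
         (use \<open>surj g\<close> strict_mono_mono[OF g_mono] in \<open>auto simp: mono_def\<close>)
    show "strict_mono g" "surj g" by fact+
    show "g (s + \<tau>) = g s + real N" for s
      using e_shift[of "g s" 1] ge[of "g s + real N"] by (simp add: eg)
    show "g (h i) = of_int i" for i
      using ge[of "of_int i"] by (simp add: e_def)
  qed
qed

text \<open>The induced map of circles is continuous since a full turn of angles is a compact interval
  mapping onto the first circle, which is therefore a quotient of it.\<close>

lemma homeo_of_lift: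
  fixes g :: "real \<Rightarrow> real"
  assumes C: "oriented_circle C" and C': "oriented_circle C'"
    and g: "continuous_on UNIV g" "strict_mono g" "surj g" "\<And>s. g (s + 2 * pi) = g s + 2 * pi"
  obtains \<phi> where "orientation_preserving_homeo C C' \<phi>"
    "\<And>s. \<phi> (at_angle C s) = at_angle C' (g s)"
proof -
  have g_shift: "g (s + of_int n * (2 * pi)) = g s + of_int n * (2 * pi)" for s n
    using int_shift_invariant[of "\<lambda>x. g x - x = g s - s" "2 * pi" s n] g(4) by (simp add: algebra_simps)
  have well: "at_angle C s = at_angle C s' \<longleftrightarrow> at_angle C' (g s) = at_angle C' (g s')" for s s'
    unfolding at_angle_eq_iff[OF C] at_angle_eq_iff[OF C']
    by (metis g_shift strict_mono_eq[OF g(2)])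
  define \<phi> where "\<phi> x = at_angle C' (g (SOME s. at_angle C s = x))" for x
  have \<phi>: "\<phi> (at_angle C s) = at_angle C' (g s)" for s
    unfolding \<phi>_def using well someI[of "\<lambda>s'. at_angle C s' = at_angle C s" s] by blast
  have im: "\<phi> ` points C = points C'"
  proof
    show "\<phi> ` points C \<subseteq> points C'"
      unfolding \<phi>_def using at_angle_in_points[OF C'] by blast
    show "points C' \<subseteq> \<phi> ` points C"
    proof
      fix x assume "x \<in> points C'"
      then obtain s where "at_angle C' s = x" using ex_angle[OF C'] by blast
      moreover obtain r where "s = g r" using g(3) by (metis surjD)
      ultimately show "x \<in> \<phi> ` points C" using \<phi> at_angle_in_points[OF C] by (metis imageI)
    qed
  qed
  have inj: "inj_on \<phi> (points C)"
  proof (rule inj_onI)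
    fix x x' assume x: "x \<in> points C" "x' \<in> points C" and eq: "\<phi> x = \<phi> x'"
    obtain s where s: "at_angle C s = x" using ex_angle[OF C x(1)] by blast
    obtain s' where s': "at_angle C s' = x'" using ex_angle[OF C x(2)] by blast
    show "x = x'" using eq well unfolding s[symmetric] s'[symmetric] \<phi> by blast
  qed
  have comp: "compact_space (space_of C)"
  proof -
    have "compactin (space_of C) (at_angle C ` {0..2 * pi})"
      by (rule image_compactin[OF _ continuous_at_angle[OF C]]) simp
    then show ?thesis by (simp add: compact_space_def at_angle_full_turn[OF C])
  qed
  have cont: "continuous_map (space_of C) (space_of C') \<phi>"
  proof (rule continuous_compose_quotient_map)
    show "quotient_map (top_of_set {0..2 * pi}) (space_of C) (at_angle C)"
    proof (rule continuous_imp_quotient_map)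
      show "continuous_map (top_of_set {0..2 * pi}) (space_of C) (at_angle C)"
        by (rule continuous_map_from_subtopology[OF continuous_at_angle[OF C]])
      show "at_angle C ` topspace (top_of_set {0..2 * pi}) = points C"
        using at_angle_full_turn[OF C] by simp
    qed (use Hausdorff_circle[OF C] in \<open>auto simp: compact_space_subtopology\<close>)
    have "\<phi> \<circ> at_angle C = at_angle C' \<circ> g" using \<phi> by auto
    moreover have "continuous_map euclideanreal euclideanreal g" using g(1) by simp
    then have "continuous_map euclideanreal (space_of C') (at_angle C' \<circ> g)"
      by (rule continuous_map_compose[OF _ continuous_at_angle[OF C']])
    ultimately show "continuous_map (top_of_set {0..2 * pi}) (space_of C') (\<phi> \<circ> at_angle C)"
      by (simp add: continuous_map_from_subtopology)
  qed
  have "homeomorphic_map (space_of C) (space_of C') \<phi>"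
    by (rule continuous_imp_homeomorphic_map[OF cont comp Hausdorff_circle[OF C'] im inj])
  then have "orientation_preserving_homeo C C' \<phi>"
    using g \<phi> by (auto simp: orientation_preserving_homeo_def at_angle_def)
  then show thesis using \<phi> that by blast
qed

section \<open>Stars and the arc number\<close>

lemma oriented_standard_circle: "oriented_circle standard_circle"
  using homeomorphic_map_id[of "top_of_set (sphere (0::complex) 1)" "top_of_set (sphere 0 1)"]
  by (simp add: oriented_circle_def standard_circle_def id_def)

lemma at_angle_standard: "at_angle standard_circle s = cis s"
  by (simp add: at_angle_def standard_circle_def)

text \<open>The subdiagram is formed by the given chords; stretching angles so that \<open>h i\<close> goes to
  \<open>i / star_size p a\<close> of a full turn identifies it with the star.\<close>

lemma contains_star_if_lifts:
  fixes h :: "int \<Rightarrow> real" and a p :: nat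
  assumes D: "chord_diagram D" and p: "0 < p" and h: "strict_mono h"
    "\<And>i. h (i + int (star_size p a)) = h i + 2 * pi"
    and chords: "\<And>s. (h (2 * s), h (2 * s + 2 * int p - 1)) \<in> lifts (circle D) (crossings D)"
  shows "contains D (star p a)"
proof -
  let ?C = "circle D"
  define N where "N = star_size p a"
  have C: "oriented_circle ?C" using D by (simp add: chord_diagram_def)
  have N: "0 < N" "even N" by (auto simp: N_def star_size_def)
  define X where "X = (\<lambda>s. {at_angle ?C (h (2 * s)), at_angle ?C (h (2 * s + 2 * int p - 1))}) ` UNIV"
  have X: "X \<subseteq> crossings D" using chords by (auto simp: X_def lifts_def)
  define D' where "D' = \<lparr>circle = ?C, half_crossings = \<Union>X, crossings = X\<rparr>"
  have "chord_diagram D'"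
  proof -
    have part: "partition_on (half_crossings D) (crossings D)" and card: "\<forall>x\<in>crossings D. card x = 2"
      and H: "finite (half_crossings D)" "half_crossings D \<subseteq> points ?C"
      using D by (auto simp: chord_diagram_def)
    have "\<Union>X \<subseteq> half_crossings D" using X part by (auto simp: partition_on_def)
    then have fin: "finite (\<Union>X)" "\<Union>X \<subseteq> points ?C" using H finite_subset by auto
    have disj: "disjoint X" using partition_onD2[OF part] X by (rule pairwise_subset)
    have "partition_on (\<Union>X) X"
      by (rule partition_onI) (use disj X partition_onD3[OF part] in \<open>auto simp: pairwise_def\<close>)
    moreover have "card (\<Union>X) = 2 * card X"
    proof -
      note disj
      moreover have "\<And>x. x \<in> X \<Longrightarrow> finite x" using fin by (meson Union_upper finite_subset)
      ultimately have "card (\<Union>X) = sum card X" by (rule card_Union_disjoint)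
      then show ?thesis using card X by (simp add: subset_iff)
    qed
    ultimately show ?thesis using C fin card X by (auto simp: chord_diagram_def D'_def)
  qed
  then have sub: "subdiagram D' D" using X by (auto simp: subdiagram_def D'_def)
  obtain g :: "real \<Rightarrow> real" where g: "continuous_on UNIV g" "strict_mono g" "surj g"
    "\<And>s. g (s + 2 * pi) = g s + real N" "\<And>i. g (h i) = of_int i"
    by (rule ex_increasing_interpolation[of h N "2 * pi"]) (use h N in \<open>auto simp: N_def\<close>)
  define g' where "g' s = 2 * pi / real N * g s" for s
  have g'h: "g' (h i) = 2 * pi * of_int i / real N" for i by (simp add: g'_def g)
  obtain \<phi> where \<phi>: "orientation_preserving_homeo ?C standard_circle \<phi>"
    "\<And>s. \<phi> (at_angle ?C s) = at_angle standard_circle (g' s)"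
  proof (rule homeo_of_lift[OF C oriented_standard_circle])
    show "continuous_on UNIV g'" unfolding g'_def by (intro continuous_intros g)
    have pos: "0 < 2 * pi / real N" using N by simp
    show "strict_mono g'"
      unfolding strict_mono_def g'_def using strict_monoD[OF g(2)] pos by (intro allI impI mult_strict_left_mono)
    show "surj g'"
      unfolding surj_def
    proof
      fix s
      obtain r where "g r = s / (2 * pi / real N)" using g(3) by (metis surjD)
      then have "g' r = s" using N by (simp add: g'_def)
      then show "\<exists>r. s = g' r" by metis
    qed
    show "g' (s + 2 * pi) = g' s + 2 * pi" for s unfolding g'_def g(4) using N by (simp add: field_simps)
  qed (rule that)
  have \<phi>h: "\<phi> (at_angle ?C (h (int j))) = star_point p a j" for j
    by (simp add: \<phi>(2) g'h at_angle_standard star_point_def N_def)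
  have h_period: "at_angle ?C (h (i + n * int N)) = at_angle ?C (h i)" for i n
    using quasi_periodic_shift[of h N "2 * pi" i n] h(2) at_angle_shift[OF C, of "h i" n]
    by (simp add: N_def)
  define c where "c j = {at_angle ?C (h (int j)), at_angle ?C (h (int (j + 2 * p - 1)))}" for j :: nat
  have range: "{0..1 + 2 * (a + 1) * p} = {..<N}" by (auto simp: N_def star_size_def)
  have "X = {c j | j. j < N \<and> even j}"
  proof
    show "X \<subseteq> {c j | j. j < N \<and> even j}"
    proof
      fix x assume "x \<in> X"
      then obtain s where x: "x = {at_angle ?C (h (2 * s)), at_angle ?C (h (2 * s + 2 * int p - 1))}"
        by (auto simp: X_def)
      define j where "j = nat ((2 * s) mod int N)"
      define n where "n = (2 * s) div int N"
      have j: "int j = (2 * s) mod int N" "2 * s = int j + n * int N" "j < N"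
        using N by (auto simp: j_def n_def nat_less_iff)
      have "even (int j)" using j(2) N(2) by (metis even_add even_mult_iff even_of_nat dvd_triv_left)
      moreover have *: "2 * s + 2 * int p - 1 = int (j + 2 * p - 1) + n * int N" using j(2) p by simp
      have "x = c j" unfolding x * unfolding j(2) h_period c_def ..
      ultimately show "x \<in> {c j | j. j < N \<and> even j}" using j(3) by auto
    qed
    show "{c j | j. j < N \<and> even j} \<subseteq> X"
    proof clarify
      fix j :: nat assume "even j"
      then obtain s where "j = 2 * s" by blast
      then show "c j \<in> X" using p by (auto simp: c_def X_def intro!: image_eqI[of _ _ "int s"] simp: of_nat_diff)
    qed
  qed
  then have "{\<phi> ` x | x. x \<in> X} = {\<phi> ` c j | j. j < N \<and> even j}" by blast
  moreover have "\<phi> ` c j = star_crossing p a j" for j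
    using \<phi>h[of j] \<phi>h[of "j + 2 * p - 1"] by (simp add: c_def star_crossing_def)
  ultimately have "{\<phi> ` x | x. x \<in> X} = {star_crossing p a j | j. j < N \<and> even j}"
    by simp
  then have "{\<phi> ` x | x. x \<in> crossings D'} = crossings (star p a)"
    unfolding star_def range by (simp add: D'_def)
  then have "equivalent D' (star p a)"
    using \<phi>(1) by (auto simp: equivalent_def D'_def star_def)
  then show ?thesis using sub by (auto simp: contains_def)
qed

text \<open>On the standard circle, the arc from \<open>star_point t a j\<close> to \<open>star_point t a (j + 2 * t - 1)\<close>, pulled back
  to the circle of \<open>D\<close>, is connected and contains a crossing, so it contains a cut point. For even
  \<open>j\<close> these arcs are intervals as in the counting bound, with \<open>p = t\<close> and \<open>q = 1 + (a + 1) * t\<close>.\<close>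

lemma card_ge_if_contains_star:
  assumes D: "chord_diagram D" and t: "0 < t" and star: "contains D (star t a)"
    and P: "embedded_partition D P"
  shows "a + 2 \<le> card P"
proof -
  let ?C = "circle D"
  define N where "N = star_size t a"
  define q where "q = 1 + (a + 1) * t"
  have N: "N = 2 * q" by (simp add: N_def q_def star_size_def)
  obtain D' \<phi> where sub: "subdiagram D' D" and \<phi>: "orientation_preserving_homeo ?C standard_circle \<phi>"
    and X: "{\<phi> ` x | x. x \<in> crossings D'} = crossings (star t a)"
    using star by (auto simp: contains_def equivalent_def star_def subdiagram_def)
  have "homeomorphic_map (space_of ?C) (top_of_set (sphere 0 1)) \<phi>"
    using \<phi> by (simp add: orientation_preserving_homeo_def standard_circle_def)
  then obtain \<psi> where \<psi>: "homeomorphic_maps (space_of ?C) (top_of_set (sphere 0 1)) \<phi> \<psi>"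
    using homeomorphic_map_maps by blast
  have P': "finite P" "P \<subseteq> points ?C" using P by (auto simp: embedded_partition_def regular_points_def)
  define Q where "Q = (\<lambda>x. Arg (\<phi> x)) ` P"
  have Q: "finite Q" "card Q \<le> card P" using P' by (auto simp: Q_def card_image_le)
  have in_Q: "s \<in> translates (2 * pi) Q" if "x \<in> P" "cis s = \<phi> x" for s x
  proof -
    have "cis (Arg (\<phi> x)) = cis s" using that(2) rcis_cmod_Arg[of "\<phi> x"] 
      by (metis norm_cis rcis_def mult_1 of_real_1)
    then obtain n :: int where "s = Arg (\<phi> x) + of_int n * (2 * pi)" unfolding cis_eq_iff by blast
    then show ?thesis using that(1) by (auto simp: translates_def Q_def)
  qed
  define y where "y s = 2 * pi * (2 * of_int s) / real N" for s :: int
  have "0 < q" by (simp add: q_def)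
  then have N0: "0 < real N" by (simp add: N)
  have "card {0..<int q} \<le> t * card Q"
  proof (rule card_hit_intervals_le[of "2 * pi" q y])
    show "strict_mono y" using N0 by (auto simp: strict_mono_def y_def divide_strict_right_mono)
    show "y (s + int q) = y s + 2 * pi" for s using N0 by (simp add: y_def N field_simps)
    fix s assume s: "s \<in> {0..<int q}"
    show "translates (2 * pi) Q \<inter> {y s..<y (s + int t)} \<noteq> {}"
    proof
      assume empty: "translates (2 * pi) Q \<inter> {y s..<y (s + int t)} = {}"
      define j where "j = nat (2 * s)"
      have j: "int j = 2 * s" "even j" "j < N" using s by (auto simp: j_def N even_nat_iff)
      define l where "l = 2 * pi * real j / real N"
      define r where "r = 2 * pi * real (j + 2 * t - 1) / real N"
      have "real j = 2 * of_int s" using j(1) by linarith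
      have l: "l = y s" using \<open>real j = 2 * of_int s\<close> by (simp add: l_def y_def)
      have "real (j + 2 * t - 1) < 2 * of_int (s + int t)" "real j \<le> real (j + 2 * t - 1)"
        using \<open>real j = 2 * of_int s\<close> t by (simp_all add: of_nat_diff)
      then have r: "r < y (s + int t)" "l \<le> r"
        using N0 by (auto simp: l_def r_def y_def divide_strict_right_mono divide_right_mono)
      define K where "K = \<psi> ` cis ` {l..r}"
      have conn: "connectedin (space_of ?C) K"
        unfolding K_def
      proof (rule connectedin_continuous_map_image)
        show "continuous_map (top_of_set (sphere 0 1)) (space_of ?C) \<psi>"
          using \<psi> by (simp add: homeomorphic_maps_def)
        have "connected (cis ` {l..r})" by (intro connected_continuous_image continuous_intros) simp
        then show "connectedin (top_of_set (sphere 0 1)) (cis ` {l..r})"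
          by (auto simp: connectedin_subtopology)
      qed
      have "K \<inter> P = {}"
      proof (rule ccontr)
        assume "K \<inter> P \<noteq> {}"
        then obtain s' where s': "s' \<in> {l..r}" "\<psi> (cis s') \<in> P" unfolding K_def by blast
        have "cis s' = \<phi> (\<psi> (cis s'))" using \<psi> by (simp add: homeomorphic_maps_def)
        then have "s' \<in> translates (2 * pi) Q" using in_Q[OF s'(2)] by simp
        then show False using empty s'(1) l r by auto
      qed
      have "star_crossing t a j \<in> crossings (star t a)"
      proof -
        have "j \<in> {0..1 + 2 * (a + 1) * t}" using j(3) by (auto simp: N_def star_size_def)
        then show ?thesis using j(2) unfolding star_def by auto
      qed
      then have "star_crossing t a j \<in> {\<phi> ` x | x. x \<in> crossings D'}" unfolding X .
      then obtain x where x: "x \<in> crossings D'" "\<phi> ` x = star_crossing t a j" by blast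
      then have xD: "x \<in> crossings D" using sub by (auto simp: subdiagram_def)
      then have "x \<subseteq> points ?C" "card x = 2" using D by (auto simp: chord_diagram_def partition_on_def)
      have "x = \<psi> ` \<phi> ` x"
        using \<psi> \<open>x \<subseteq> points ?C\<close> by (force simp: homeomorphic_maps_def image_iff)
      also have "\<dots> = {\<psi> (cis l), \<psi> (cis r)}"
        unfolding x(2) by (simp add: star_crossing_def star_point_def l_def r_def N_def)
      also have "\<dots> \<subseteq> K" using r by (auto simp: K_def)
      finally have "x \<subseteq> K" .
      moreover have "x \<noteq> {}" using \<open>card x = 2\<close> by auto
      ultimately show False
        using connected_contains_no_crossing[OF P conn \<open>K \<inter> P = {}\<close> xD] by blast
    qed
  qed (use Q in \<open>auto simp: q_def\<close>)
  then have "q \<le> t * card P"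
    using Q(2) by (simp, meson le_trans mult_le_mono2)
  then have "t * (a + 1) < t * card P" by (simp add: q_def algebra_simps)
  then have "a + 1 < card P" by (simp only: mult_less_cancel1)
  then show ?thesis by simp
qed

theorem theorem2p4:
  fixes a :: nat and D :: "'p diagram"
  assumes "a > 0" and "chord_diagram D"
  shows "arc_number D \<ge> a + 2 \<longleftrightarrow> (\<exists>t::nat. t > 0 \<and> contains D (star t a))"
proof
  assume "\<exists>t::nat. t > 0 \<and> contains D (star t a)"
  then obtain t where t: "0 < t" "contains D (star t a)" by auto
  have "\<exists>n P. embedded_partition D P \<and> card P = n" using ex_embedded_partition[OF assms(2)] by blast
  from LeastI_ex[OF this] obtain P where P: "embedded_partition D P" "card P = arc_number D"
    unfolding arc_number_def[symmetric] by blast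
  from card_ge_if_contains_star[OF assms(2) t P(1)] show "a + 2 \<le> arc_number D"
    unfolding P(2) .
next
  assume arc: "a + 2 \<le> arc_number D"
  let ?C = "circle D"
  let ?L = "angles ?C (half_crossings D)"
  have C: "oriented_circle ?C" using assms by (simp add: chord_diagram_def)
  have lc: "lifted_chords (2 * pi) ?L (lifts ?C (crossings D))"
    by (rule lifted_chords_diagram[OF assms(2)])
  have bound: "a + 1 < card Q" if Q: "finite Q" "Q \<noteq> {}" "Q \<inter> ?L = {}"
    "\<forall>(u, v)\<in>lifts ?C (crossings D). hits (2 * pi) Q u v" for Q
  proof -
    have "embedded_partition D (at_angle ?C ` Q)"
      using embedded_partition_if_hits[OF assms(2) Q(1-3)] Q(4) by blast
    then have "arc_number D \<le> card (at_angle ?C ` Q)"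
      unfolding arc_number_def by (intro Least_le) blast
    also have "\<dots> \<le> card Q" using Q(1) by (rule card_image_le)
    finally show ?thesis using arc by linarith
  qed
  have "unhittable (2 * pi) ?L (a + 1) (lifts ?C (crossings D))"
    unfolding unhittable_def
  proof (intro allI impI, elim conjE)
    fix Q assume Q: "finite Q" "Q \<inter> ?L = {}" "\<forall>(u, v)\<in>lifts ?C (crossings D). hits (2 * pi) Q u v"
    \<comment> \<open>The empty cut set defines no arcs. It hits all chords only if there are none, and then a single cut does so too.\<close>
    show "a + 1 < card Q"
    proof (cases "Q = {}")
      case True
      then have "lifts ?C (crossings D) = {}" using Q(3) by (auto simp: hits_def translates_def)
      obtain c where "c < 0" "?L \<inter> {c..<0} = {}"
        using ex_gap_below lifted_chords.L[OF lc] by blast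
      then have "a + 1 < card {c}"
        using \<open>lifts ?C (crossings D) = {}\<close> by (intro bound) auto
      then show ?thesis by simp
    qed (use bound Q in blast)
  qed
  from star_in_unhittable[OF lc this]
  obtain p :: nat and h :: "int \<Rightarrow> real" where p: "0 < p" "strict_mono h"
    "\<And>i. h (i + 2 * (int (a + 1) * int p + 1)) = h i + 2 * pi"
    "\<And>s. (h (2 * s), h (2 * s + 2 * int p - 1)) \<in> lifts ?C (crossings D)"
    using assms(1) by auto
  have "int (star_size p a) = 2 * (int (a + 1) * int p + 1)" by (simp add: star_size_def algebra_simps)
  then have "contains D (star p a)"
    using p by (intro contains_star_if_lifts[OF assms(2)]) auto
  then show "\<exists>t::nat. t > 0 \<and> contains D (star t a)" using p(1) by blast
qed

end
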